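(* Consider the control-affine system $\dot{\mathbf x}=\mathbf f(\mathbf x)+\mathbf g(\mathbf x)\mathbf u$ with $\mathbf x\in\mathbb R^n$, $\mathbf u\in\mathbb R^m$, and smooth $\mathbf f:\mathbb R^n\to\mathbb R^n$, $\mathbf g:\mathbb R^n\to\mathbb R^{n\times m}$. Let $\mathbf H:\mathbb R^n\to\mathbb S^p$ be smooth, with associated functions $\boldsymbol\Psi_1,\dots,\boldsymbol\Psi_r$ and sets $\mathcal C_i=\{\mathbf x\in\mathbb R^n : \boldsymbol\Psi_i(\mathbf x)\succeq \mathbf 0\}$, $i\in\{1,\dots,r\}$, as defined in the context. If $\mathbf H$ has matrix relative degree $r$ on an open neighborhood of the boundary of $\bigcap_{i=1}^r\mathcal C_i$ where $\boldsymbol\Psi_r\not\succ\mathbf 0$, namely of $$\partial\Big(\bigcap_{i=1}^r\mathcal C_i\Big)\cap\partial\mathcal C_r,$$ then $\mathbf H$ is an optimal decay high-order matrix control barrier function (OD-HOMCBF) on $\bigcap_{i=1}^r\mathcal C_i$. Consequently, there exists a continuous feedback controller $\mathbf k:\mathbb R^n\to\mathbb R^m$ such that the set $\bigcap_{i=1}^r\mathcal C_i$ is forward invariant for the closed-loop system under $\mathbf u=\mathbf k(\mathbf x)$.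
   Context: $\mathbb S^p$ is the set of real symmetric $p\times p$ matrices; $\succeq$, $\succ$ denote the positive semidefinite / positive definite ordering; $\partial$ denotes the boundary of a set. $\mathbf g_j$ is the $j$-th column of $\mathbf g$. Matrix Lie derivative: for $\mathbf A:\mathbb R^n\to\mathbb S^p$ and a vector field $\mathbf w$, $\mathbf L_{\mathbf w}\mathbf A(\mathbf x)$ is the matrix with entries $\nabla A_{ij}(\mathbf x)^\top\mathbf w(\mathbf x)$; $\mathbf L_{\mathbf f}^k$ denotes the $k$-fold iterate. Extended class-$\mathcal K^e$ function: a continuous, strictly increasing $\alpha:\mathbb R\to\mathbb R$ with $\alpha(0)=0$. The bold $\boldsymbol\alpha:\mathbb S^p\to\mathbb S^p$ is defined spectrally from $\alpha$: $\boldsymbol\alpha(Q\,\mathrm{diag}(\lambda_1,\dots,\lambda_p)Q^\top)=Q\,\mathrm{diag}(\alpha(\lambda_1),\dots,\alpha(\lambda_p))Q^\top$ for $Q$ orthogonal. Recursive functions: with extended class-$\mathcal K^e$ functions $\alpha_1,\dots,\alpha_{r-1}$, set $\boldsymbol\Psi_1=\mathbf H$ and $\boldsymbol\Psi_{i+1}(\mathbf x)=\mathbf L_{\mathbf f}\boldsymbol\Psi_i(\mathbf x)+\boldsymbol\alpha_i(\boldsymbol\Psi_i(\mathbf x))$ for $i\in\{1,\dots,r-1\}$. Here $r\in\mathbb N$ is the first level for which there exists $j\in\{1,\dots,m\}$ such that $\mathbf L_{\mathbf g_j}\boldsymbol\Psi_r\not\equiv\mathbf 0$. Notation: $\dot{\boldsymbol\Psi}_r(\mathbf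 x,\mathbf u)=\mathbf L_{\mathbf f}\boldsymbol\Psi_r(\mathbf x)+\sum_{j=1}^m\mathbf L_{\mathbf g_j}\boldsymbol\Psi_r(\mathbf x)\,u_j$. Matrix relative degree: $\mathbf H$ has matrix relative degree $r$ at $\mathbf x$ if (1) $\mathbf L_{\mathbf g_j}\mathbf L_{\mathbf f}^k\mathbf H(\mathbf x)=\mathbf 0$ for each $j\in\{1,\dots,m\}$ and each $k\in\{0,\dots,r-2\}$; and (2) there exists $\mathbf u\in\mathbb R^m$ such that $\mathbf V_r(\mathbf x)^\top\big(\sum_{j=1}^m\mathbf L_{\mathbf g_j}\mathbf L_{\mathbf f}^{r-1}\mathbf H(\mathbf x)\,u_j\big)\mathbf V_r(\mathbf x)\succ\mathbf 0$, where $\mathbf V_r(\mathbf x)$ is a matrix whose columns form an orthonormal basis of the eigenspace of $\boldsymbol\Psi_r(\mathbf x)$ associated with its smallest eigenvalue. It has matrix relative degree $r$ on a set if this holds at every point of the set. OD-HOMCBF: $\mathbf H$ is an optimal decay high-order matrix control barrier function for the system if there exists an extended class-$\mathcal K^e$ function $\alpha_r$ such that for each $\mathbf x\in\bigcap_{i=1}^r\mathcal C_i$ there exist $\mathbf u\in\mathbb R^m$ and $\omega\in\mathbb R_{\ge0}$ with $\dot{\boldsymbol\Psi}_r(\mathbf x,\mathbf u)\succ-\omega\,\boldsymbol\alpha_r(\boldsymbol\Psi_r(\mathbf x))$. Forward invariance: a set is forward invariant for the closed-loop system if trajectories starting in the set remain in it for all time $t\ge0$.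
   Formalization: Added assumptions: the points of ∩C_i where Ψ_r is not ≻0 are exactly ∂(∩C_i)∩∂C_r (fails for H=x², where the claim is false), and each Ψ_i is of class C^{r-i+1}, since merely continuous α_i need not make Ψ_i differentiable. Trajectories remain in the set while they exist. *)

theory Defs
  imports "HOL-Analysis.Analysis"
begin

subsection \<open>Matrix orderings, eigenspaces, spectral functions\<close>

text \<open>Symmetry is part of both predicates. The library order on vectors is componentwise and
  therefore is not the positive semidefinite order.\<close>

definition pos_semidef :: "real^'p^'p \<Rightarrow> bool" where
  "pos_semidef A \<longleftrightarrow> transpose A = A \<and> (\<forall>v. 0 \<le> v \<bullet> (A *v v))"

definition pos_def :: "real^'p^'p \<Rightarrow> bool" where
  "pos_def A \<longleftrightarrow> transpose A = A \<and> (\<forall>v. v \<noteq> 0 \<longrightarrow> 0 < v \<bullet> (A *v v))"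

text \<open>Positive definiteness of a \<open>q \<times> q\<close> matrix whose size \<open>q\<close> is a number, not a type;
  only the entries \<open>B a b\<close> with \<open>a, b < q\<close> matter.\<close>

definition pos_def_upto :: "nat \<Rightarrow> (nat \<Rightarrow> nat \<Rightarrow> real) \<Rightarrow> bool" where
  "pos_def_upto q B \<longleftrightarrow>
     (\<forall>a<q. \<forall>b<q. B a b = B b a) \<and>
     (\<forall>c. (\<exists>a<q. c a \<noteq> 0) \<longrightarrow> 0 < (\<Sum>a<q. \<Sum>b<q. c a * B a b * c b))"

definition eigenspace :: "real^'p^'p \<Rightarrow> real \<Rightarrow> (real^'p) set" where
  "eigenspace A l = {v. A *v v = l *\<^sub>R v}"

definition is_eigenvalue :: "real^'p^'p \<Rightarrow> real \<Rightarrow> bool" where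
  "is_eigenvalue A l \<longleftrightarrow> (\<exists>v. v \<noteq> 0 \<and> v \<in> eigenspace A l)"

definition min_eigenvalue :: "real^'p^'p \<Rightarrow> real" where
  "min_eigenvalue A = (LEAST l. is_eigenvalue A l)"

definition orthonormal_basis_of :: "nat \<Rightarrow> (nat \<Rightarrow> 'a::euclidean_space) \<Rightarrow> 'a set \<Rightarrow> bool" where
  "orthonormal_basis_of q V E \<longleftrightarrow>
     (\<forall>a<q. \<forall>b<q. V a \<bullet> V b = (if a = b then 1 else 0)) \<and> span (V ` {..<q}) = E"

definition diag_mat :: "real^'p \<Rightarrow> real^'p^'p" where
  "diag_mat d = (\<chi> i j. if i = j then d $ i else 0)"

definition spectral_map :: "(real \<Rightarrow> real) \<Rightarrow> real^'p^'p \<Rightarrow> real^'p^'p" where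
  "spectral_map \<alpha> A =
     (THE B. \<exists>Q d. orthogonal_matrix Q \<and> A = Q ** diag_mat d ** transpose Q \<and>
        B = Q ** diag_mat (\<chi> i. \<alpha> (d $ i)) ** transpose Q)"

text \<open>The result does not depend on the chosen diagonalisation, so the definite description
  denotes the spectral function whenever \<open>A\<close> is orthogonally diagonalisable.\<close>

lemma spectral_map_eq:
  fixes Q :: "real^'p^'p"
  assumes Q: "orthogonal_matrix Q" and A: "A = Q ** diag_mat d ** transpose Q"
  shows "spectral_map \<alpha> A = Q ** diag_mat (\<chi> i. \<alpha> (d $ i)) ** transpose Q"
  unfolding spectral_map_def
proof (rule the_equality)
  show "\<exists>Q' d'. orthogonal_matrix Q' \<and> A = Q' ** diag_mat d' ** transpose Q' \<and>
      Q ** diag_mat (\<chi> i. \<alpha> (d $ i)) ** transpose Q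
        = Q' ** diag_mat (\<chi> i. \<alpha> (d' $ i)) ** transpose Q'"
    using Q A by blast
next
  have left: "(diag_mat e ** W) $ i $ j = e $ i * W $ i $ j" for e and W :: "real^'p^'p" and i j
    by (simp add: diag_mat_def matrix_matrix_mult_def if_distrib if_distribR
        cong: if_cong)
  have right: "(W ** diag_mat e) $ i $ j = W $ i $ j * e $ j" for e and W :: "real^'p^'p" and i j
    by (simp add: diag_mat_def matrix_matrix_mult_def if_distrib if_distribR
        cong: if_cong)
  fix B
  assume "\<exists>Q d. orthogonal_matrix Q \<and> A = Q ** diag_mat d ** transpose Q \<and>
      B = Q ** diag_mat (\<chi> i. \<alpha> (d $ i)) ** transpose Q"
  then obtain R e where R: "orthogonal_matrix R" and A': "A = R ** diag_mat e ** transpose R"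
    and B: "B = R ** diag_mat (\<chi> i. \<alpha> (e $ i)) ** transpose R"
    by blast
  have QQ: "transpose Q ** Q = mat 1" "Q ** transpose Q = mat 1"
    and RR: "transpose R ** R = mat 1" "R ** transpose R = mat 1"
    using Q R by (auto simp: orthogonal_matrix_def)
  define W where "W = transpose R ** Q"
  have "W ** diag_mat d = transpose R ** A ** Q"
    using QQ by (simp add: A W_def matrix_mul_assoc[symmetric])
  also have "\<dots> = diag_mat e ** W"
    using RR by (simp add: A' W_def matrix_mul_assoc)
  finally have comm: "W $ i $ j * d $ j = e $ i * W $ i $ j" for i j
    by (metis left right)
  have "W $ i $ j * \<alpha> (d $ j) = \<alpha> (e $ i) * W $ i $ j" for i j
    using comm[of i j] by (cases "W $ i $ j = 0") auto
  then have W: "W ** diag_mat (\<chi> i. \<alpha> (d $ i)) = diag_mat (\<chi> i. \<alpha> (e $ i)) ** W"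
    by (simp add: vec_eq_iff left right)
  have "B = R ** (diag_mat (\<chi> i. \<alpha> (e $ i)) ** W) ** transpose Q"
    using QQ by (simp add: B W_def matrix_mul_assoc[symmetric])
  also have "\<dots> = Q ** diag_mat (\<chi> i. \<alpha> (d $ i)) ** transpose Q"
    using RR by (simp add: W[symmetric]) (simp add: W_def matrix_mul_assoc)
  finally show "B = Q ** diag_mat (\<chi> i. \<alpha> (d $ i)) ** transpose Q" .
qed

definition class_Ke :: "(real \<Rightarrow> real) \<Rightarrow> bool" where
  "class_Ke \<alpha> \<longleftrightarrow> continuous_on UNIV \<alpha> \<and> strict_mono \<alpha> \<and> \<alpha> 0 = 0"

subsection \<open>Differentiability classes and Lie derivatives\<close>

text \<open>Class \<open>C\<^sup>k\<close> on the whole space: all directional derivatives of order at most \<open>k\<close> exist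
  and are continuous.\<close>

primrec Ck :: "nat \<Rightarrow> ('a::euclidean_space \<Rightarrow> 'b::euclidean_space) \<Rightarrow> bool" where
  "Ck 0 f \<longleftrightarrow> continuous_on UNIV f"
| "Ck (Suc k) f \<longleftrightarrow> (\<exists>f'. (\<forall>x. (f has_derivative f' x) (at x)) \<and> (\<forall>v. Ck k (\<lambda>x. f' x v)))"

definition smooth :: "('a::euclidean_space \<Rightarrow> 'b::euclidean_space) \<Rightarrow> bool" where
  "smooth f \<longleftrightarrow> (\<forall>k. Ck k f)"

definition lie :: "(real^'n \<Rightarrow> real^'n) \<Rightarrow> (real^'n \<Rightarrow> real^'p^'p) \<Rightarrow> real^'n \<Rightarrow> real^'p^'p" where
  "lie w A x = (\<chi> i j. frechet_derivative (\<lambda>y. A y $ i $ j) (at x) (w x))"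

subsection \<open>High-order matrix control barrier functions\<close>

text \<open>Levels are numbered from 1; level 0 is a dummy value.\<close>

fun Psi :: "(real^'n \<Rightarrow> real^'n) \<Rightarrow> (nat \<Rightarrow> real \<Rightarrow> real) \<Rightarrow> (real^'n \<Rightarrow> real^'p^'p)
    \<Rightarrow> nat \<Rightarrow> real^'n \<Rightarrow> real^'p^'p" where
  "Psi f \<alpha> H 0 = H"
| "Psi f \<alpha> H (Suc 0) = H"
| "Psi f \<alpha> H (Suc (Suc i)) =
     (\<lambda>x. lie f (Psi f \<alpha> H (Suc i)) x + spectral_map (\<alpha> (Suc i)) (Psi f \<alpha> H (Suc i) x))"

definition Cset :: "(real^'n \<Rightarrow> real^'n) \<Rightarrow> (nat \<Rightarrow> real \<Rightarrow> real) \<Rightarrow> (real^'n \<Rightarrow> real^'p^'p)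
    \<Rightarrow> nat \<Rightarrow> (real^'n) set" where
  "Cset f \<alpha> H i = {x. pos_semidef (Psi f \<alpha> H i x)}"

definition safe_set :: "(real^'n \<Rightarrow> real^'n) \<Rightarrow> (nat \<Rightarrow> real \<Rightarrow> real) \<Rightarrow> (real^'n \<Rightarrow> real^'p^'p)
    \<Rightarrow> nat \<Rightarrow> (real^'n) set" where
  "safe_set f \<alpha> H r = (\<Inter>i\<in>{1..r}. Cset f \<alpha> H i)"

definition first_control_level :: "(real^'n \<Rightarrow> real^'n) \<Rightarrow> (real^'n \<Rightarrow> real^'m^'n)
    \<Rightarrow> (nat \<Rightarrow> real \<Rightarrow> real) \<Rightarrow> (real^'n \<Rightarrow> real^'p^'p) \<Rightarrow> nat \<Rightarrow> bool" where
  "first_control_level f g \<alpha> H r \<longleftrightarrow> 1 \<le> r \<and>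
     (\<forall>i\<in>{1..<r}. \<forall>j x. lie (\<lambda>y. column j (g y)) (Psi f \<alpha> H i) x = 0) \<and>
     (\<exists>j x. lie (\<lambda>y. column j (g y)) (Psi f \<alpha> H r) x \<noteq> 0)"

definition Psi_dot :: "(real^'n \<Rightarrow> real^'n) \<Rightarrow> (real^'n \<Rightarrow> real^'m^'n)
    \<Rightarrow> (nat \<Rightarrow> real \<Rightarrow> real) \<Rightarrow> (real^'n \<Rightarrow> real^'p^'p) \<Rightarrow> nat
    \<Rightarrow> real^'n \<Rightarrow> real^'m \<Rightarrow> real^'p^'p" where
  "Psi_dot f g \<alpha> H r x u =
     lie f (Psi f \<alpha> H r) x
     + (\<Sum>j\<in>UNIV. u $ j *\<^sub>R lie (\<lambda>y. column j (g y)) (Psi f \<alpha> H r) x)"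

text \<open>The number \<open>q\<close> of columns of \<open>V\<close> is the dimension of the eigenspace and varies with \<open>x\<close>;
  the matrix \<open>V\<^sup>T M V\<close> is given by its entries \<open>V a \<bullet> (M *v V b)\<close>. Positive definiteness of
  \<open>V\<^sup>T M V\<close> does not depend on the chosen orthonormal basis.\<close>

definition matrix_relative_degree :: "(real^'n \<Rightarrow> real^'n) \<Rightarrow> (real^'n \<Rightarrow> real^'m^'n)
    \<Rightarrow> (nat \<Rightarrow> real \<Rightarrow> real) \<Rightarrow> (real^'n \<Rightarrow> real^'p^'p) \<Rightarrow> nat \<Rightarrow> real^'n \<Rightarrow> bool" where
  "matrix_relative_degree f g \<alpha> H r x \<longleftrightarrow>
     (\<forall>j k. k + 2 \<le> r \<longrightarrow> lie (\<lambda>y. column j (g y)) ((lie f ^^ k) H) x = 0) \<and>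
     (\<exists>q V. orthonormal_basis_of q V
              (eigenspace (Psi f \<alpha> H r x) (min_eigenvalue (Psi f \<alpha> H r x))) \<and>
        (\<exists>u :: real^'m.
           let M = (\<Sum>j\<in>UNIV. u $ j *\<^sub>R lie (\<lambda>y. column j (g y)) ((lie f ^^ (r - 1)) H) x)
           in pos_def_upto q (\<lambda>a b. V a \<bullet> (M *v V b))))"

definition OD_HOMCBF :: "(real^'n \<Rightarrow> real^'n) \<Rightarrow> (real^'n \<Rightarrow> real^'m^'n)
    \<Rightarrow> (nat \<Rightarrow> real \<Rightarrow> real) \<Rightarrow> (real^'n \<Rightarrow> real^'p^'p) \<Rightarrow> nat \<Rightarrow> bool" where
  "OD_HOMCBF f g \<alpha> H r \<longleftrightarrow>
     (\<exists>\<alpha>\<^sub>r. class_Ke \<alpha>\<^sub>r \<and>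
        (\<forall>x\<in>safe_set f \<alpha> H r. \<exists>u \<omega>. 0 \<le> \<omega> \<and>
           pos_def (Psi_dot f g \<alpha> H r x u - (- (\<omega> *\<^sub>R spectral_map \<alpha>\<^sub>r (Psi f \<alpha> H r x))))))"

text \<open>A trajectory is a solution on any interval of nonnegative times containing 0. A continuous
  closed loop may have several solutions from one initial state, and solutions may escape in finite
  time; every solution has to stay in the set as long as it exists.\<close>

definition forward_invariant :: "('a::euclidean_space \<Rightarrow> 'a) \<Rightarrow> 'a set \<Rightarrow> bool" where
  "forward_invariant F S \<longleftrightarrow>
     (\<forall>J x. is_interval J \<and> 0 \<in> J \<and> J \<subseteq> {0..} \<and>
        (\<forall>t\<in>J. (x has_vector_derivative F (x t)) (at t within J)) \<and> x 0 \<in> S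
        \<longrightarrow> (\<forall>t\<in>J. x t \<in> S))"

end

(*
  Optimal decay.  At a point of the safe set where Psi_r is singular, the relative degree condition
  gives u making M(u) = sum_j u_j L_{g_j} L_f^{r-1} H positive definite on ker Psi_r.  A large
  multiple of u dominates the drift on the compact unit sphere of ker Psi_r, and a large multiple of
  Psi_r then makes the sum positive definite everywhere (Finsler's lemma).

  This needs L_{g_j} Psi_r = L_{g_j} L_f^{r-1} H, which is not a chain rule computation since the
  alpha_i are only continuous.  If L_w Psi_i vanishes identically, then Psi_i is constant along the
  integral curves of w, so alpha_i(Psi_i) is as well and L_w of it vanishes; applied to the iterated
  Lie brackets w = ad_f^k g_j, this removes every alpha_i from the recursion.

  Feedback.  The admissible inputs at x form a convex set, and a fixed input stays admissible near x,
  so a partition of unity on the closed safe set gives a continuous selection k, extended by Tietze.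
  If a closed-loop solution is in the safe set at time t, the decay inequality keeps Psi_r positive
  semidefinite shortly after t.  For i < r the input does not enter and
  d/dt Psi_i = Psi_{i+1} - alpha_i(Psi_i), so a comparison argument descends from Psi_r to Psi_1.
*)
theory Submission
  imports Defs
begin

subsection \<open>Diagonalisation of symmetric matrices\<close>

lemma quadratic_nonneg_linear_zero:
  fixes b c :: real
  assumes "\<And>s. 0 \<le> s * b + s\<^sup>2 * c"
  shows "b = 0"
proof (rule ccontr)
  assume "b \<noteq> 0"
  \<comment> \<open>At \<open>s = - b / d\<close> the expression equals \<open>b^2 / d\<close> times
    \<open>c / d - 1\<close>, which is negative for every positive \<open>d\<close> above
    \<open>c\<close>.\<close>
  define d where "d = \<bar>c\<bar> + 1"
  have d: "d > 0" "c < d" by (auto simp: d_def)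
  have "0 \<le> (- b / d) * b + (- b / d)\<^sup>2 * c" by (rule assms)
  also have "\<dots> = (b\<^sup>2 / d) * (c / d - 1)"
    using d by (simp add: field_simps power2_eq_square)
  also have "\<dots> < 0"
    using d \<open>b \<noteq> 0\<close> by (intro mult_pos_neg) (auto simp: field_simps)
  finally show False by simp
qed

lemma inner_matrix_sym:
  fixes A :: "real^'p^'p"
  assumes "transpose A = A"
  shows "v \<bullet> (A *v w) = (A *v v) \<bullet> w"
  by (metis assms dot_lmul_matrix vector_transpose_matrix)

lemma quadratic_form_expand:
  fixes A :: "real^'p^'p"
  assumes "transpose A = A"
  shows "(v + s *\<^sub>R w) \<bullet> (A *v (v + s *\<^sub>R w))
    = v \<bullet> (A *v v) + s * (2 * ((A *v v) \<bullet> w)) + s\<^sup>2 * (w \<bullet> (A *v w))"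
  using inner_matrix_sym[OF assms, of w v] inner_matrix_sym[OF assms, of v w]
  by (simp add: matrix_vector_right_distrib matrix_vector_mult_scaleR
      algebra_simps power2_eq_square inner_commute)

text \<open>Perturbing \<open>v\<close> in the direction \<open>A *v v\<close> changes the form to
  first order by twice the squared length of \<open>A *v v\<close>, and a form that is nonnegative
  and vanishes at \<open>v\<close> has no first-order change. The hypothesis
  \<open>A *v v \<in> T\<close> keeps the perturbed vector inside \<open>T\<close>.\<close>

lemma psd_on_subspace_null:
  fixes A :: "real^'p^'p"
  assumes A: "transpose A = A" and T: "subspace T"
    and nn: "\<And>w. w \<in> T \<Longrightarrow> 0 \<le> w \<bullet> (A *v w)"
    and v: "v \<in> T" "A *v v \<in> T" "v \<bullet> (A *v v) = 0"
  shows "A *v v = 0"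
proof -
  let ?w = "A *v v"
  have "0 \<le> s * (2 * (?w \<bullet> ?w)) + s\<^sup>2 * (?w \<bullet> (A *v ?w))" for s
    using nn[of "v + s *\<^sub>R ?w"] v T
    by (simp add: quadratic_form_expand[OF A] subspace_add subspace_scale)
  from quadratic_nonneg_linear_zero[OF this] show ?thesis by simp
qed

lemma pos_semidef_null:
  assumes "pos_semidef A" "v \<bullet> (A *v v) = 0"
  shows "A *v v = 0"
  using assms psd_on_subspace_null[of A UNIV v] by (simp add: pos_semidef_def)

text \<open>Subtracting the minimal value times the identity leaves a form that is nonnegative on
  \<open>T\<close> and vanishes at \<open>v\<close>, so \<open>v\<close> is a null vector of the
  shifted matrix. Invariant subspaces occur in the diagonalisation, the whole space in the
  comparison argument.\<close>

lemma rayleigh_min_eigenvector: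
  fixes A :: "real^'p^'p"
  assumes A: "transpose A = A" and T: "subspace T"
    and inv: "A *v v \<in> T" and v: "v \<in> T" "norm v = 1"
    and min: "\<And>w. w \<in> T \<Longrightarrow> norm w = 1 \<Longrightarrow> v \<bullet> (A *v v) \<le> w \<bullet> (A *v w)"
  shows "A *v v = (v \<bullet> (A *v v)) *\<^sub>R v"
proof -
  define l where "l = v \<bullet> (A *v v)"
  define B where "B = A - l *\<^sub>R mat 1"
  have Bv: "B *v w = A *v w - l *\<^sub>R w" for w
    by (simp add: B_def matrix_vector_mult_diff_rdistrib scaleR_matrix_vector_assoc[symmetric])
  have "transpose B = B"
    using A by (simp add: B_def transpose_def vec_eq_iff mat_def)
  moreover have "0 \<le> w \<bullet> (B *v w)" if "w \<in> T" for w
  proof (cases "w = 0")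
    case False
    have "l \<le> (w /\<^sub>R norm w) \<bullet> (A *v (w /\<^sub>R norm w))"
      unfolding l_def using that False T by (intro min) (auto simp: subspace_scale)
    also have "\<dots> = (w \<bullet> (A *v w)) / (norm w)\<^sup>2"
      using False by (simp add: matrix_vector_mult_scaleR field_simps power2_eq_square)
    finally show ?thesis using False
      by (simp add: Bv inner_diff_right field_simps power2_norm_eq_inner)
  qed simp
  moreover have "B *v v \<in> T" using inv v T by (simp add: Bv subspace_diff subspace_scale)
  moreover have "v \<bullet> (B *v v) = 0"
    using v by (simp add: Bv inner_diff_right l_def norm_eq_1)
  ultimately have "B *v v = 0" using psd_on_subspace_null[of B T v] T v by blast
  then show ?thesis by (simp add: Bv l_def)
qed

lemma continuous_on_quadratic_form: "continuous_on X (\<lambda>v. v \<bullet> ((A::real^'p^'p) *v v))"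
  by (intro continuous_intros matrix_vector_mult_linear_continuous_on)

lemma symmetric_eigenvector_in_subspace:
  fixes A :: "real^'p^'p"
  assumes A: "transpose A = A" and T: "subspace T" "T \<noteq> {0}"
    and inv: "\<And>v. v \<in> T \<Longrightarrow> A *v v \<in> T"
  obtains v l where "v \<in> T" "norm v = 1" "A *v v = l *\<^sub>R v"
proof -
  let ?K = "sphere 0 1 \<inter> T"
  obtain w where w: "w \<in> T" "w \<noteq> 0" using T subspace_0 by blast
  then have "w /\<^sub>R norm w \<in> ?K" using T by (auto simp: subspace_scale)
  moreover have "compact ?K"
    using closed_subspace[OF T(1)] by (auto intro: compact_Int_closed)
  ultimately obtain v where "v \<in> ?K" "\<And>w. w \<in> ?K \<Longrightarrow> v \<bullet> (A *v v) \<le> w \<bullet> (A *v w)"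
    using continuous_attains_inf[OF _ _ continuous_on_quadratic_form, of ?K A] by blast
  then have "A *v v = (v \<bullet> (A *v v)) *\<^sub>R v" "v \<in> T" "norm v = 1"
    using rayleigh_min_eigenvector[OF A T(1), of v] inv by auto
  then show thesis using that by blast
qed

text \<open>An orthonormal set of eigenvectors of maximal size is complete: by symmetry
  \<open>A\<close> maps its orthogonal complement to itself, so a nonzero complement would contain a
  further unit eigenvector.\<close>

lemma symmetric_eigenbasis:
  fixes A :: "real^'p^'p"
  assumes A: "transpose A = A"
  obtains B where "finite B" "pairwise orthogonal B" "\<And>b. b \<in> B \<Longrightarrow> norm b = 1"
    "card B = CARD('p)" "\<And>b. b \<in> B \<Longrightarrow> \<exists>l. A *v b = l *\<^sub>R b"
proof -
  define P where "P B \<longleftrightarrow> finite B \<and> pairwise orthogonal B \<and>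
    (\<forall>b\<in>B. norm b = 1 \<and> (\<exists>l. A *v b = l *\<^sub>R b))" for B
  have indep: "independent B" if "P B" for B
    using that pairwise_orthogonal_independent[of B] by (force simp: P_def)
  have le: "card B \<le> CARD('p)" if "P B" for B
    using independent_bound[OF indep[OF that]] by simp
  have "P {}" by (simp add: P_def)
  then obtain B where B: "P B" and max: "\<And>C. P C \<Longrightarrow> card C \<le> card B"
    using ex_has_greatest_nat[of P "{}" card "Suc CARD('p)"] le by (metis less_Suc_eq_le)
  let ?T = "{v. \<forall>b\<in>B. b \<bullet> v = 0}"
  have T: "subspace ?T"
    by (auto simp: subspace_def inner_add_right)
  have "?T = {0}"
  proof (rule ccontr)
    assume ne: "?T \<noteq> {0}"
    have "A *v v \<in> ?T" if v: "v \<in> ?T" for v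
    proof safe
      fix b assume b: "b \<in> B"
      with B obtain l where "A *v b = l *\<^sub>R b" by (auto simp: P_def)
      with b v show "b \<bullet> (A *v v) = 0" by (simp add: inner_matrix_sym[OF A])
    qed
    then obtain v l where v: "v \<in> ?T" "norm v = 1" "A *v v = l *\<^sub>R v"
      using symmetric_eigenvector_in_subspace[OF A T ne] by blast
    have "v \<notin> B" using v by (auto simp: norm_eq_1)
    moreover have "P (insert v B)"
      using B v by (auto simp: P_def pairwise_insert orthogonal_def inner_commute)
    ultimately show False using max[of "insert v B"] B by (auto simp: P_def)
  qed
  have "span B = UNIV"
  proof (rule ccontr)
    assume "span B \<noteq> UNIV"
    then obtain a where "a \<noteq> 0" "\<forall>x\<in>span B. a \<bullet> x = 0"
      using span_not_UNIV_orthogonal by blast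
    then have "a \<in> ?T" by (auto simp: inner_commute span_base)
    with \<open>?T = {0}\<close> \<open>a \<noteq> 0\<close> show False by blast
  qed
  then have "card B = CARD('p)"
    by (metis DIM_cart DIM_real dim_UNIV dim_span dim_span_eq_card_independent indep[OF B]
        mult.right_neutral)
  with B show thesis by (intro that[of B]) (auto simp: P_def)
qed

text \<open>The columns of \<open>Q\<close> are an orthonormal eigenbasis. The existence of
  \<open>Q\<close> is what gives the definite description in \<open>spectral_map\<close> a value on
  every symmetric matrix.\<close>

theorem symmetric_diagonalization:
  fixes A :: "real^'p^'p"
  assumes A: "transpose A = A"
  obtains Q d where "orthogonal_matrix Q" "A = Q ** diag_mat d ** transpose Q"
proof -
  obtain B where B: "finite B" "pairwise orthogonal B" "\<And>b. b \<in> B \<Longrightarrow> norm b = 1"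
    "card B = CARD('p)" "\<And>b. b \<in> B \<Longrightarrow> \<exists>l. A *v b = l *\<^sub>R b"
    using symmetric_eigenbasis[OF A] by metis
  obtain e :: "'p \<Rightarrow> _" where e: "bij_betw e UNIV B"
    using B(1,4) finite_same_card_bij[of "UNIV::'p set" B] by auto
  then have eB: "e i \<in> B" for i by (auto simp: bij_betw_def)
  obtain L where L: "\<And>b. b \<in> B \<Longrightarrow> A *v b = L b *\<^sub>R b" using B(5) by metis
  define Q where "Q = (\<chi> i j. e j $ i)"
  have "e i \<bullet> e j = (if i = j then 1 else 0)" for i j
  proof (cases "i = j")
    case False
    then have "e i \<noteq> e j" using e by (auto simp: bij_betw_def inj_eq)
    then show ?thesis using B(2) eB False by (auto simp: pairwise_def orthogonal_def)
  qed (use B(3) eB in \<open>auto simp: norm_eq_1\<close>)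
  then have Q: "transpose Q ** Q = mat 1"
    by (simp add: vec_eq_iff matrix_matrix_mult_def transpose_def Q_def mat_def inner_vec_def)
  then have oQ: "orthogonal_matrix Q" by (simp add: orthogonal_matrix)
  define D where "D = (diag_mat (\<chi> j. L (e j)) :: real^'p^'p)"
  have "A ** Q = Q ** D"
  proof -
    have "(A ** Q) $ i $ j = (Q ** D) $ i $ j" for i j
    proof -
      have "(A ** Q) $ i $ j = (A *v e j) $ i"
        by (simp add: matrix_matrix_mult_def matrix_vector_mult_def Q_def)
      also have "\<dots> = L (e j) * e j $ i" using L[OF eB] by simp
      finally show ?thesis
        by (simp add: matrix_matrix_mult_def D_def diag_mat_def Q_def if_distrib cong: if_cong)
    qed
    then show ?thesis by (simp add: vec_eq_iff)
  qed
  then have "A = Q ** D ** transpose Q"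
    using oQ by (metis matrix_mul_assoc matrix_mul_rid orthogonal_matrix_def)
  with oQ show thesis using that D_def by blast
qed

section \<open>Spectral functions of symmetric matrices\<close>

lemma transpose_diag_mat: "transpose (diag_mat d) = diag_mat d"
  by (simp add: transpose_def diag_mat_def vec_eq_iff)

lemma transpose_spectral_map:
  fixes A :: "real^'p^'p"
  assumes "transpose A = A"
  shows "transpose (spectral_map \<alpha> A) = spectral_map \<alpha> A"
proof -
  obtain Q d where Q: "orthogonal_matrix Q" and A: "A = Q ** diag_mat d ** transpose Q"
    using symmetric_diagonalization[OF assms] .
  show ?thesis
    by (simp add: spectral_map_eq[OF Q A] matrix_transpose_mul transpose_diag_mat matrix_mul_assoc)
qed

text \<open>The identity is the function chosen for \<open>\<alpha>\<^sub>r\<close>, which turns the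
  decay term into a multiple of the matrix itself.\<close>

lemma spectral_map_id:
  fixes A :: "real^'p^'p"
  assumes "transpose A = A"
  shows "spectral_map (\<lambda>x. x) A = A"
proof -
  obtain Q d where Q: "orthogonal_matrix Q" and A: "A = Q ** diag_mat d ** transpose Q"
    using symmetric_diagonalization[OF assms] .
  show ?thesis by (subst spectral_map_eq[OF Q A]) (simp add: A[symmetric])
qed

text \<open>In the coordinates \<open>w\<close> with respect to the columns of \<open>Q\<close>, an
  eigenvector for \<open>l\<close> is supported on the indices with \<open>d $ i = l\<close>, and
  there the new diagonal is constantly \<open>\<alpha> l\<close>.\<close>

lemma spectral_map_eigenvector:
  fixes A :: "real^'p^'p"
  assumes "transpose A = A" and v: "A *v v = l *\<^sub>R v"
  shows "spectral_map \<alpha> A *v v = \<alpha> l *\<^sub>R v"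
proof -
  obtain Q d where Q: "orthogonal_matrix Q" and A: "A = Q ** diag_mat d ** transpose Q"
    using symmetric_diagonalization[OF assms(1)] .
  define w where "w = transpose Q *v v"
  have v': "v = Q *v w"
    using Q by (metis matrix_vector_mul_assoc matrix_vector_mul_lid orthogonal_matrix_def w_def)
  have diag: "(diag_mat e *v w) $ i = e $ i * w $ i" for e i
    by (simp add: diag_mat_def matrix_vector_mult_def if_distrib if_distribR cong: if_cong)
  have "diag_mat d *v w = transpose Q *v (A *v v)"
    using Q by (simp add: A w_def matrix_vector_mul_assoc matrix_mul_assoc orthogonal_matrix_def
        del: transpose_matrix_vector)
  also have "\<dots> = l *\<^sub>R w" by (simp add: v w_def matrix_vector_mult_scaleR del: transpose_matrix_vector)
  finally have "d $ i * w $ i = l * w $ i" for i by (metis diag vector_scaleR_component real_scaleR_def)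
  then have "d $ i = l \<or> w $ i = 0" for i by auto
  then have "diag_mat (\<chi> i. \<alpha> (d $ i)) *v w = \<alpha> l *\<^sub>R w"
    by (simp add: vec_eq_iff diag) metis
  then show ?thesis
    by (simp add: spectral_map_eq[OF Q A] matrix_vector_mul_assoc[symmetric] w_def[symmetric]
        del: transpose_matrix_vector)
       (simp add: v' matrix_vector_mult_scaleR)
qed

subsection \<open>Differentiability classes and Lie brackets\<close>

text \<open>\<open>lie\<close> works entrywise on matrix fields; this version has an arbitrary
  Euclidean codomain, so that one operator acts on matrix fields and on the vector fields entering a
  bracket. The two agree where the field is differentiable.\<close>

definition ddir :: "('a::euclidean_space \<Rightarrow> 'a) \<Rightarrow> ('a \<Rightarrow> 'b::euclidean_space) \<Rightarrow> 'a \<Rightarrow> 'b" where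
  "ddir w F x = frechet_derivative F (at x) (w x)"

definition lie_bracket :: "('a::euclidean_space \<Rightarrow> 'a) \<Rightarrow> ('a \<Rightarrow> 'a) \<Rightarrow> 'a \<Rightarrow> 'a" where
  "lie_bracket f w x = ddir f w x - ddir w f x"

lemma ddir_eq: "(F has_derivative F') (at x) \<Longrightarrow> ddir w F x = F' (w x)"
  by (metis ddir_def frechet_derivative_at)

section \<open>Closure properties of the classes \<open>Ck\<close>\<close>

lemma Ck_SucI:
  "(\<And>x. (f has_derivative f' x) (at x)) \<Longrightarrow> (\<And>v. Ck k (\<lambda>x. f' x v)) \<Longrightarrow> Ck (Suc k) f"
  by auto

lemma Ck_SucE:
  assumes "Ck (Suc k) f"
  obtains f' where "\<And>x. (f has_derivative f' x) (at x)" "\<And>v. Ck k (\<lambda>x. f' x v)"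
  using assms by auto

lemma Ck_differentiable: "Ck (Suc k) f \<Longrightarrow> f differentiable (at x)"
  by (auto simp: differentiable_def)

lemma Ck_continuous: "Ck k f \<Longrightarrow> continuous_on UNIV f"
  by (cases k) (auto intro: has_derivative_continuous_on)

lemma Ck_Suc_imp: "Ck (Suc k) f \<Longrightarrow> Ck k f"
proof (induction k arbitrary: f)
  case 0
  then show ?case using Ck_continuous[OF 0] by simp
next
  case (Suc k)
  from Suc.prems obtain f' where "\<And>x. (f has_derivative f' x) (at x)" "\<And>v. Ck (Suc k) (\<lambda>x. f' x v)"
    by (rule Ck_SucE) blast
  with Suc.IH show ?case by (auto simp del: Ck.simps(2) simp: Ck.simps(2)[of k f])
qed

lemma Ck_le: "k \<le> m \<Longrightarrow> Ck m f \<Longrightarrow> Ck k f"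
  by (induction rule: dec_induct) (auto intro: Ck_Suc_imp simp del: Ck.simps)

lemma Ck_const: "Ck k (\<lambda>x. c)"
proof (induction k arbitrary: c)
  case (Suc k)
  show ?case unfolding Ck.simps
    by (rule exI[of _ "\<lambda>x v. 0"]) (use Suc in simp)
qed simp

lemma Ck_bounded_linear:
  assumes T: "bounded_linear T" and "Ck k f"
  shows "Ck k (\<lambda>x. T (f x))"
  using assms(2)
proof (induction k arbitrary: f)
  case 0
  then show ?case by (simp add: bounded_linear.continuous_on[OF T])
next
  case (Suc k)
  from Suc.prems obtain f' where f': "\<And>x. (f has_derivative f' x) (at x)" "\<And>v. Ck k (\<lambda>x. f' x v)"
    by (rule Ck_SucE) blast
  have "((\<lambda>x. T (f x)) has_derivative (\<lambda>v. T (f' x v))) (at x)" for x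
    by (rule bounded_linear.has_derivative[OF T f'(1)])
  then show ?case using Suc.IH[OF f'(2)] by (rule Ck_SucI)
qed

lemma Ck_add:
  assumes "Ck k f" "Ck k h"
  shows "Ck k (\<lambda>x. f x + h x)"
  using assms
proof (induction k arbitrary: f h)
  case 0
  then show ?case by (simp add: continuous_on_add)
next
  case (Suc k)
  from Suc.prems(1) obtain f' where f': "\<And>x. (f has_derivative f' x) (at x)" "\<And>v. Ck k (\<lambda>x. f' x v)"
    by (rule Ck_SucE) blast
  from Suc.prems(2) obtain h' where h': "\<And>x. (h has_derivative h' x) (at x)" "\<And>v. Ck k (\<lambda>x. h' x v)"
    by (rule Ck_SucE) blast
  have "((\<lambda>x. f x + h x) has_derivative (\<lambda>v. f' x v + h' x v)) (at x)" for x
    using f' h' by (intro has_derivative_add)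
  then show ?case using Suc.IH[OF f'(2) h'(2)] by (rule Ck_SucI)
qed

lemma Ck_diff:
  assumes "Ck k f" "Ck k h"
  shows "Ck k (\<lambda>x. f x - h x)"
  using Ck_add[OF assms(1) Ck_bounded_linear[OF bounded_linear_minus[OF bounded_linear_ident] assms(2)]]
  by simp

lemma Ck_sum:
  assumes "\<And>i. i \<in> I \<Longrightarrow> Ck k (f i)"
  shows "Ck k (\<lambda>x. \<Sum>i\<in>I. f i x)"
  using assms by (induction I rule: infinite_finite_induct) (auto intro: Ck_add Ck_const)

lemma Ck_scaleR:
  assumes "Ck k a" "Ck k f"
  shows "Ck k (\<lambda>x. a x *\<^sub>R f x)"
  using assms
proof (induction k arbitrary: a f)
  case 0
  then show ?case by (simp add: continuous_on_scaleR)
next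
  case (Suc k)
  from Suc.prems(1) obtain a' where a': "\<And>x. (a has_derivative a' x) (at x)" "\<And>v. Ck k (\<lambda>x. a' x v)"
    by (rule Ck_SucE) blast
  from Suc.prems(2) obtain f' where f': "\<And>x. (f has_derivative f' x) (at x)" "\<And>v. Ck k (\<lambda>x. f' x v)"
    by (rule Ck_SucE) blast
  have "((\<lambda>x. a x *\<^sub>R f x) has_derivative (\<lambda>v. a x *\<^sub>R f' x v + a' x v *\<^sub>R f x)) (at x)" for x
    using a' f' by (intro has_derivative_scaleR)
  moreover have "Ck k (\<lambda>x. a x *\<^sub>R f' x v + a' x v *\<^sub>R f x)" for v
    using Suc.prems a' f' by (intro Ck_add Suc.IH) (auto intro: Ck_Suc_imp simp del: Ck.simps(2))
  ultimately show ?case by (rule Ck_SucI)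
qed

lemma linear_basis_expand:
  fixes T :: "'a::euclidean_space \<Rightarrow> 'b::real_vector"
  assumes "linear T"
  shows "T v = (\<Sum>b\<in>Basis. (v \<bullet> b) *\<^sub>R T b)"
proof -
  have "T v = T (\<Sum>b\<in>Basis. (v \<bullet> b) *\<^sub>R b)" by (simp add: euclidean_representation)
  also have "\<dots> = (\<Sum>b\<in>Basis. (v \<bullet> b) *\<^sub>R T b)"
    by (simp add: linear_sum[OF assms] linear_scale[OF assms])
  finally show ?thesis .
qed

text \<open>\<open>Ck\<close> controls derivatives in fixed directions, while \<open>ddir\<close>
  uses a direction that moves with the point; the basis expansion reduces the second to the
  first.\<close>

lemma ddir_basis_expand:
  assumes "\<And>x. (F has_derivative F' x) (at x)"
  shows "ddir w F = (\<lambda>x. \<Sum>b\<in>Basis. (w x \<bullet> b) *\<^sub>R F' x b)"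
  by (rule ext) (subst ddir_eq[OF assms], rule linear_basis_expand[OF has_derivative_linear[OF assms]])

lemma Ck_ddir:
  assumes "Ck (Suc k) F" "Ck k w"
  shows "Ck k (ddir w F)"
proof -
  from assms(1) obtain F' where F': "\<And>x. (F has_derivative F' x) (at x)" "\<And>v. Ck k (\<lambda>x. F' x v)"
    by (rule Ck_SucE) blast
  show ?thesis
    unfolding ddir_basis_expand[OF F'(1)]
    using assms(2) F' by (intro Ck_sum Ck_scaleR Ck_bounded_linear[OF bounded_linear_inner_left])
qed

lemma smooth_ddir: "smooth F \<Longrightarrow> smooth w \<Longrightarrow> smooth (ddir w F)"
  by (simp add: smooth_def Ck_ddir del: Ck.simps)

lemma smooth_lie_bracket: "smooth f \<Longrightarrow> smooth w \<Longrightarrow> smooth (lie_bracket f w)"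
  using smooth_ddir[of w f] smooth_ddir[of f w]
  by (auto simp: smooth_def lie_bracket_def[abs_def] intro: Ck_diff)

lemma ddir_diff:
  assumes "F differentiable (at x)" "G differentiable (at x)"
  shows "ddir w (\<lambda>y. F y - G y) x = ddir w F x - ddir w G x"
  using ddir_eq[OF has_derivative_diff[OF assms[THEN frechet_derivative_works[THEN iffD1]]]]
  by (simp add: ddir_def)

lemma ddir_zero: "ddir w (\<lambda>x. 0) = (\<lambda>x. 0)"
  by (simp add: ddir_def fun_eq_iff)

text \<open>The second difference of \<open>\<phi>\<close> over a small square, divided by its area, is by the mean value
  theorem a value of either mixed derivative near the corner.\<close>

lemma second_difference_mean_value:
  fixes \<phi> :: "'a::euclidean_space \<Rightarrow> real"
  assumes d1: "\<And>y. (\<phi> has_derivative \<phi>' y) (at y)"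
    and d2: "\<And>y. ((\<lambda>y. \<phi>' y b) has_derivative \<phi>'' y) (at y)"
    and h: "h > 0"
  obtains s t where "0 < s" "s < h" "0 < t" "t < h"
    "\<phi> (x + h *\<^sub>R b + h *\<^sub>R c) - \<phi> (x + h *\<^sub>R b) - \<phi> (x + h *\<^sub>R c) + \<phi> x
      = h\<^sup>2 * \<phi>'' (x + s *\<^sub>R b + t *\<^sub>R c) c"
proof -
  define F where "F s = \<phi> (x + s *\<^sub>R b + h *\<^sub>R c) - \<phi> (x + s *\<^sub>R b)" for s
  have Fd: "(F has_derivative
      (\<lambda>v. v * (\<phi>' (x + s *\<^sub>R b + h *\<^sub>R c) b - \<phi>' (x + s *\<^sub>R b) b))) (at s)" for s
  proof -
    have "((\<lambda>s. \<phi> (x + s *\<^sub>R b + k)) has_derivative (\<lambda>v. \<phi>' (x + s *\<^sub>R b + k) (v *\<^sub>R b))) (at s)" for k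
      by (rule has_derivative_compose[OF _ d1]) (auto intro!: derivative_eq_intros)
    from has_derivative_diff[OF this[of "h *\<^sub>R c"] this[of 0]]
    show ?thesis
      using linear_scale[OF has_derivative_linear[OF d1]]
      by (simp add: F_def[abs_def] right_diff_distrib)
  qed
  obtain s where s: "0 < s" "s < h"
    "F h - F 0 = h * (\<phi>' (x + s *\<^sub>R b + h *\<^sub>R c) b - \<phi>' (x + s *\<^sub>R b) b)"
    using mvt_simple[OF h, of F, OF has_derivative_at_withinI[OF Fd]] by auto
  define G where "G t = \<phi>' (x + s *\<^sub>R b + t *\<^sub>R c) b" for t
  have Gd: "(G has_derivative (\<lambda>v. v * \<phi>'' (x + s *\<^sub>R b + t *\<^sub>R c) c)) (at t)" for t
  proof -
    have "(G has_derivative (\<lambda>v. \<phi>'' (x + s *\<^sub>R b + t *\<^sub>R c) (v *\<^sub>R c))) (at t)"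
      unfolding G_def[abs_def]
      by (rule has_derivative_compose[OF _ d2]) (auto intro!: derivative_eq_intros)
    then show ?thesis using linear_scale[OF has_derivative_linear[OF d2]] by simp
  qed
  obtain t where t: "0 < t" "t < h" "G h - G 0 = h * \<phi>'' (x + s *\<^sub>R b + t *\<^sub>R c) c"
    using mvt_simple[OF h, of G, OF has_derivative_at_withinI[OF Gd]] by auto
  have "F h - F 0 = h * (G h - G 0)" using s(3) by (simp add: G_def)
  with t(3) have "F h - F 0 = h\<^sup>2 * \<phi>'' (x + s *\<^sub>R b + t *\<^sub>R c) c" by (simp add: power2_eq_square)
  then show thesis using s t by (intro that[of s t]) (auto simp: F_def)
qed

text \<open>As the square shrinks, the intermediate point converges to the corner, where the mixed
  derivative is continuous.\<close>

lemma second_difference_tendsto: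
  fixes \<phi> :: "'a::euclidean_space \<Rightarrow> real"
  assumes d1: "\<And>y. (\<phi> has_derivative \<phi>' y) (at y)"
    and d2: "\<And>y. ((\<lambda>y. \<phi>' y b) has_derivative \<phi>'' y) (at y)"
    and cont: "continuous_on UNIV (\<lambda>y. \<phi>'' y c)"
  shows "((\<lambda>h. (\<phi> (x + h *\<^sub>R b + h *\<^sub>R c) - \<phi> (x + h *\<^sub>R b) - \<phi> (x + h *\<^sub>R c) + \<phi> x) / h\<^sup>2)
    \<longlongrightarrow> \<phi>'' x c) (at_right 0)"
    (is "(?D \<longlongrightarrow> _) _")
proof (rule tendstoI)
  fix e :: real assume e: "e > 0"
  have "continuous (at x) (\<lambda>y. \<phi>'' y c)"
    using cont by (simp add: continuous_on_eq_continuous_at)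
  then obtain d where d: "d > 0" "\<And>y. dist y x < d \<Longrightarrow> dist (\<phi>'' y c) (\<phi>'' x c) < e"
    using e unfolding continuous_at_eps_delta by blast
  \<comment> \<open>With this bound on the side length the whole parallelogram lies within
    \<open>d\<close> of \<open>x\<close>; the summand 1 covers \<open>b = c = 0\<close>.\<close>
  define \<delta> where "\<delta> = d / (norm b + norm c + 1)"
  have pos: "norm b + norm c + 1 > 0" by (smt (verit) norm_ge_zero)
  then have \<delta>: "\<delta> > 0" using d by (simp add: \<delta>_def)
  have "dist (?D h) (\<phi>'' x c) < e" if h: "0 < h" "h < \<delta>" for h
  proof -
    obtain s t where st: "0 < s" "s < h" "0 < t" "t < h"
      "\<phi> (x + h *\<^sub>R b + h *\<^sub>R c) - \<phi> (x + h *\<^sub>R b) - \<phi> (x + h *\<^sub>R c) + \<phi> x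
        = h\<^sup>2 * \<phi>'' (x + s *\<^sub>R b + t *\<^sub>R c) c"
      using second_difference_mean_value[OF d1 d2 h(1)] by metis
    have "norm (s *\<^sub>R b + t *\<^sub>R c) \<le> s * norm b + t * norm c"
      by (rule norm_triangle_le) (use st in auto)
    also have "\<dots> \<le> h * norm b + h * norm c"
      using st by (intro add_mono mult_right_mono) auto
    also have "\<dots> \<le> h * (norm b + norm c + 1)" using h by (simp add: algebra_simps)
    also have "\<dots> < \<delta> * (norm b + norm c + 1)" using h pos by (intro mult_strict_right_mono) auto
    also have "\<dots> = d" using pos by (simp add: \<delta>_def)
    finally have "dist (x + s *\<^sub>R b + t *\<^sub>R c) x < d" by (simp add: dist_norm add.assoc)
    from d(2)[OF this] show ?thesis using st(5) h by simp
  qed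
  then show "\<forall>\<^sub>F h in at_right 0. dist (?D h) (\<phi>'' x c) < e"
    using \<delta> by (auto simp: eventually_at_right_field)
qed

text \<open>The second difference is symmetric in \<open>b\<close> and \<open>c\<close>, so both
  mixed derivatives are its limit. Components are treated separately because the mean value argument
  is for real-valued maps.\<close>

lemma symmetric_second_derivative:
  fixes F :: "'a::euclidean_space \<Rightarrow> 'b::euclidean_space"
  assumes d1: "\<And>y. (F has_derivative F' y) (at y)"
    and d2: "\<And>v y. ((\<lambda>y. F' y v) has_derivative F'' v y) (at y)"
    and cont: "\<And>v w. continuous_on UNIV (\<lambda>y. F'' v y w)"
  shows "F'' b x c = F'' c x b"
proof (rule euclidean_eqI)
  fix e :: 'b assume "e \<in> Basis"
  have d1': "((\<lambda>y. F y \<bullet> e) has_derivative (\<lambda>v. F' y v \<bullet> e)) (at y)" for y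
    using d1 by (rule has_derivative_inner_left)
  have d2': "((\<lambda>y. F' y v \<bullet> e) has_derivative (\<lambda>w. F'' v y w \<bullet> e)) (at y)" for v y
    using d2 by (rule has_derivative_inner_left)
  have cont': "continuous_on UNIV (\<lambda>y. F'' v y w \<bullet> e)" for v w
    using cont by (intro continuous_intros)
  have bc: "x + h *\<^sub>R c + h *\<^sub>R b = x + h *\<^sub>R b + h *\<^sub>R c" for h by (simp add: ac_simps)
  have swap: "(a - p - q + r) = (a - q - p + r)" for a p q r :: real by simp
  show "F'' b x c \<bullet> e = F'' c x b \<bullet> e"
    using tendsto_unique[OF _ second_difference_tendsto[OF d1' d2' cont', of x b c]]
      second_difference_tendsto[OF d1' d2' cont', of x c b]
    unfolding bc by (subst (asm) swap) (auto simp: trivial_limit_at_right_real)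
qed

text \<open>The second-order terms of the two iterated derivatives cancel by symmetry, and the
  first-order terms combine to the derivative of \<open>A\<close> along the bracket.\<close>

lemma ddir_commutator:
  fixes A :: "'a::euclidean_space \<Rightarrow> 'b::euclidean_space"
  assumes "Ck (Suc (Suc 0)) A" "Ck (Suc 0) f" "Ck (Suc 0) w"
  shows "ddir w (ddir f A) x = ddir f (ddir w A) x - ddir (lie_bracket f w) A x"
proof -
  from assms(1) obtain A' where A': "\<And>x. (A has_derivative A' x) (at x)"
      and C1: "\<And>v. Ck (Suc 0) (\<lambda>x. A' x v)"
    by (rule Ck_SucE) blast
  from C1 have "\<forall>v. \<exists>D. (\<forall>x. ((\<lambda>x. A' x v) has_derivative D x) (at x)) \<and> (\<forall>u. Ck 0 (\<lambda>x. D x u))"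
    by simp
  then obtain A'' where A'': "\<And>v x. ((\<lambda>x. A' x v) has_derivative A'' v x) (at x)"
      and C0: "\<And>v u. continuous_on UNIV (\<lambda>x. A'' v x u)"
    by (simp only: Ck.simps) metis
  have lin': "linear (A' x)" for x using A' by (rule has_derivative_linear)
  have sym: "A'' b x c = A'' c x b" for b c x
    by (rule symmetric_second_derivative[OF A' A'' C0])
  \<comment> \<open>Product rule: the first term differentiates the field \<open>h\<close>, the
    double sum differentiates the derivative of \<open>A\<close>.\<close>
  have dd: "ddir u (ddir h A) x = A' x (ddir u h x) + (\<Sum>b\<in>Basis. \<Sum>c\<in>Basis. (h x \<bullet> b) *\<^sub>R (u x \<bullet> c) *\<^sub>R A'' b x c)"
    if "Ck (Suc 0) h" for h u
  proof -
    from that obtain h' where h': "\<And>x. (h has_derivative h' x) (at x)"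
      by (rule Ck_SucE) blast
    have "(ddir h A has_derivative
        (\<lambda>v. \<Sum>b\<in>Basis. (h x \<bullet> b) *\<^sub>R A'' b x v + (h' x v \<bullet> b) *\<^sub>R A' x b)) (at x)"
      unfolding ddir_basis_expand[OF A']
      by (intro has_derivative_sum has_derivative_scaleR has_derivative_inner_left h' A'')
    then have "ddir u (ddir h A) x = (\<Sum>b\<in>Basis. (h x \<bullet> b) *\<^sub>R A'' b x (u x)) +
        (\<Sum>b\<in>Basis. (ddir u h x \<bullet> b) *\<^sub>R A' x b)"
      by (simp add: ddir_eq sum.distrib ddir_eq[OF h'])
    moreover have "A'' b x (u x) = (\<Sum>c\<in>Basis. (u x \<bullet> c) *\<^sub>R A'' b x c)" for b
      by (rule linear_basis_expand[OF has_derivative_linear[OF A'']])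
    ultimately show ?thesis
      by (simp add: linear_basis_expand[OF lin', of x "ddir u h x"] scaleR_sum_right)
  qed
  have "(\<Sum>b\<in>Basis. \<Sum>c\<in>Basis. (f x \<bullet> b) *\<^sub>R (w x \<bullet> c) *\<^sub>R A'' b x c)
      = (\<Sum>b\<in>Basis. \<Sum>c\<in>Basis. (w x \<bullet> b) *\<^sub>R (f x \<bullet> c) *\<^sub>R A'' b x c)"
    by (subst sum.swap) (simp add: sym[of _ x] mult.commute)
  then show ?thesis
    using assms(2,3) linear_diff[OF lin']
    by (simp add: dd ddir_eq[OF A'] lie_bracket_def)
qed

subsection \<open>Integral curves\<close>

text \<open>Picard iteration: the integral operator contracts by the factor 1/2 because
  \<open>\<delta> * L \<le> 1 / 2\<close>.\<close>

lemma lipschitz_initial_value_problem: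
  fixes W :: "'a::euclidean_space \<Rightarrow> 'a"
  assumes lip: "\<And>x y. norm (W x - W y) \<le> L * norm (x - y)"
    and L: "0 \<le> L" and \<delta>: "0 < \<delta>" "\<delta> * L \<le> 1 / 2"
  obtains \<gamma> where "\<gamma> 0 = x0"
    "\<And>t. t \<in> {0..\<delta>} \<Longrightarrow> (\<gamma> has_vector_derivative W (\<gamma> t)) (at t within {0..\<delta>})"
proof -
  have contW: "continuous_on UNIV W"
    using lip L by (intro lipschitz_on_continuous_on[of L] lipschitz_onI) (auto simp: dist_norm)
  \<comment> \<open>Clamping time to \<open>{0..\<delta>}\<close> makes every iterate a bounded
    continuous function on the whole line, so that Banach's theorem applies in a complete
    space.\<close>
  define cl where "cl t = max 0 (min \<delta> t)" for t
  have cl: "cl t \<in> {0..\<delta>}" for t using \<delta> by (auto simp: cl_def)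
  have contcl: "continuous_on UNIV cl" unfolding cl_def by (intro continuous_intros)
  define T where "T \<gamma> t = x0 + integral {0..cl t} (\<lambda>s. W (\<gamma> s))" for \<gamma> :: "real \<Rightarrow>\<^sub>C 'a" and t
  have contWg: "continuous_on X (\<lambda>s. W (apply_bcontfun \<gamma> s))" for \<gamma> :: "real \<Rightarrow>\<^sub>C 'a" and X
    by (rule continuous_on_compose2[OF contW]) auto
  have contI: "continuous_on {0..\<delta>} (\<lambda>u. x0 + integral {0..u} (\<lambda>s. W (apply_bcontfun \<gamma> s)))" for \<gamma>
    by (intro continuous_intros indefinite_integral_continuous_1 integrable_continuous_real contWg)
  have T: "T \<gamma> \<in> bcontfun" for \<gamma>
  proof -
    have "continuous_on UNIV (T \<gamma>)"
      unfolding T_def[abs_def] using cl by (intro continuous_on_compose2[OF contI contcl]) auto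
    moreover have "bounded (range (T \<gamma>))"
      by (rule bounded_subset[OF compact_imp_bounded[OF compact_continuous_image[OF contI compact_Icc]]])
         (use cl in \<open>auto simp: T_def\<close>)
    ultimately show ?thesis by (simp add: bcontfun_def)
  qed
  define TT where "TT \<gamma> = Bcontfun (T \<gamma>)" for \<gamma>
  have TT: "apply_bcontfun (TT \<gamma>) = T \<gamma>" for \<gamma>
    using T by (simp add: TT_def Bcontfun_inverse)
  have "dist (TT \<beta>) (TT \<gamma>) \<le> 1 / 2 * dist \<beta> \<gamma>" for \<beta> \<gamma>
  proof (rule dist_bound)
    fix t
    have "dist (T \<beta> t) (T \<gamma> t) = norm (integral {0..cl t} (\<lambda>s. W (\<beta> s) - W (\<gamma> s)))"
      by (simp add: T_def dist_norm integral_diff integrable_continuous_real contWg)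
    also have "\<dots> \<le> (L * dist \<beta> \<gamma>) * (cl t - 0)"
    proof (rule integral_bound)
      show "norm (W (\<beta> s) - W (\<gamma> s)) \<le> L * dist \<beta> \<gamma>" for s
        using lip[of "\<beta> s" "\<gamma> s"] mult_left_mono[OF dist_bounded[of \<beta> s \<gamma>] L]
        by (simp add: dist_norm)
    qed (use cl contWg in \<open>auto intro!: continuous_intros\<close>)
    also have "\<dots> \<le> (L * dist \<beta> \<gamma>) * \<delta>"
      using L cl[of t] by (intro mult_left_mono) auto
    also have "\<dots> \<le> 1 / 2 * dist \<beta> \<gamma>"
      using mult_right_mono[OF \<delta>(2), of "dist \<beta> \<gamma>"] by (simp add: mult_ac)
    finally show "dist (TT \<beta> t) (TT \<gamma> t) \<le> 1 / 2 * dist \<beta> \<gamma>" by (simp add: TT)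
  qed
  then obtain \<gamma> where "TT \<gamma> = \<gamma>"
    using banach_fix_type[of "1/2" TT] by auto
  then have \<gamma>: "apply_bcontfun \<gamma> = T \<gamma>" by (metis TT)
  show thesis
  proof (rule that[of \<gamma>])
    have "cl 0 = 0" using \<delta> by (simp add: cl_def)
    then show "\<gamma> 0 = x0" by (subst \<gamma>) (simp add: T_def)
  next
    fix t assume t: "t \<in> {0..\<delta>}"
    have "((\<lambda>u. x0 + integral {0..u} (\<lambda>s. W (\<gamma> s))) has_vector_derivative W (\<gamma> t)) (at t within {0..\<delta>})"
      using integral_has_vector_derivative[OF contWg t]
      by (auto intro!: derivative_eq_intros)
    moreover have "\<gamma> u = x0 + integral {0..u} (\<lambda>s. W (\<gamma> s))" if "u \<in> {0..\<delta>}" for u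
      using that by (subst \<gamma>) (simp add: T_def cl_def)
    ultimately show "(\<gamma> has_vector_derivative W (\<gamma> t)) (at t within {0..\<delta>})"
      using t by (subst has_vector_derivative_cong_ev[OF always_eventually]) auto
  qed
qed

text \<open>On a compact ball the derivatives in the basis directions are bounded, and the sum of
  these bounds dominates the operator norm; convexity then gives the mean value inequality.\<close>

lemma C1_lipschitz_on_cball:
  fixes w :: "'a::euclidean_space \<Rightarrow> 'b::euclidean_space"
  assumes "Ck (Suc 0) w"
  obtains L where "0 \<le> L" "\<And>x y. x \<in> cball a R \<Longrightarrow> y \<in> cball a R \<Longrightarrow> norm (w x - w y) \<le> L * norm (x - y)"
proof -
  from assms obtain w' where w': "\<And>x. (w has_derivative w' x) (at x)" "\<And>v. continuous_on UNIV (\<lambda>x. w' x v)"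
    by (rule Ck_SucE) auto
  have "\<exists>K. \<forall>x\<in>cball a R. norm (w' x b) \<le> K" for b
    using compact_imp_bounded[OF compact_continuous_image[OF continuous_on_subset[OF w'(2)] compact_cball]]
    by (auto simp: bounded_iff)
  then obtain K where K: "\<And>x b. x \<in> cball a R \<Longrightarrow> norm (w' x b) \<le> K b" by metis
  define L where "L = (\<Sum>b\<in>Basis. \<bar>K b\<bar>)"
  have "onorm (w' x) \<le> L" if x: "x \<in> cball a R" for x
  proof (rule onorm_le)
    fix v
    have "norm (w' x v) = norm (\<Sum>b\<in>Basis. (v \<bullet> b) *\<^sub>R w' x b)"
      by (simp flip: linear_basis_expand[OF has_derivative_linear[OF w'(1)]])
    also have "\<dots> \<le> (\<Sum>b\<in>Basis. norm v * \<bar>K b\<bar>)"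
    proof (rule sum_norm_le)
      fix b :: 'a assume "b \<in> Basis"
      then have "\<bar>v \<bullet> b\<bar> * norm (w' x b) \<le> norm v * \<bar>K b\<bar>"
        using Basis_le_norm[of b v] K[OF x, of b] by (intro mult_mono) auto
      then show "norm ((v \<bullet> b) *\<^sub>R w' x b) \<le> norm v * \<bar>K b\<bar>" by simp
    qed
    finally show "norm (w' x v) \<le> L * norm v" by (simp add: L_def sum_distrib_left mult.commute)
  qed
  note onorm_bound = this
  have "norm (w x - w y) \<le> L * norm (x - y)" if "x \<in> cball a R" "y \<in> cball a R" for x y
    by (rule differentiable_bound[OF convex_cball[of a R] has_derivative_at_withinI[OF w'(1)]
        onorm_bound that])
  moreover have "0 \<le> L" by (simp add: L_def sum_nonneg)
  ultimately show thesis using that by blast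
qed

text \<open>Precomposing with the projection onto the closed unit ball around \<open>x0\<close>
  makes the field globally Lipschitz. By continuity the resulting curve stays in that ball for a
  short time, where the two fields agree.\<close>

lemma local_integral_curve:
  fixes w :: "'a::euclidean_space \<Rightarrow> 'a"
  assumes "Ck (Suc 0) w"
  obtains \<delta> \<gamma> where "\<delta> > 0" "\<gamma> 0 = x0"
    "\<And>t. t \<in> {0..\<delta>} \<Longrightarrow> (\<gamma> has_vector_derivative w (\<gamma> t)) (at t within {0..\<delta>})"
proof -
  let ?B = "cball x0 1"
  obtain L where L: "0 \<le> L" "\<And>x y. x \<in> ?B \<Longrightarrow> y \<in> ?B \<Longrightarrow> norm (w x - w y) \<le> L * norm (x - y)"
    using C1_lipschitz_on_cball[OF assms, of x0 1] by blast
  define W where "W x = w (closest_point ?B x)" for x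
  have B: "convex ?B" "closed ?B" "?B \<noteq> {}" by auto
  have "norm (W x - W y) \<le> L * norm (x - y)" for x y
    using L(2)[OF closest_point_in_set[OF B(2,3)] closest_point_in_set[OF B(2,3)], of x y]
      mult_left_mono[OF closest_point_lipschitz[OF B, of x y] L(1)]
    by (simp add: W_def dist_norm)
  moreover define d where "d = 1 / (2 * (L + 1))"
  moreover have "d * L \<le> 1 / 2" using L(1) by (simp add: d_def field_simps)
  moreover have "d > 0" using L(1) by (simp add: d_def)
  ultimately obtain \<gamma> where \<gamma>: "\<gamma> 0 = x0"
    "\<And>t. t \<in> {0..d} \<Longrightarrow> (\<gamma> has_vector_derivative W (\<gamma> t)) (at t within {0..d})"
    using lipschitz_initial_value_problem[of W L d x0] L(1) by metis
  have d: "d > 0" using L(1) by (simp add: d_def)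
  have "continuous_on {0..d} \<gamma>"
    using \<gamma>(2) has_vector_derivative_continuous by (metis continuous_on_eq_continuous_within)
  then obtain e where e: "e > 0" "\<And>t. t \<in> {0..d} \<Longrightarrow> dist t 0 < e \<Longrightarrow> dist (\<gamma> t) (\<gamma> 0) < 1"
    unfolding continuous_on_iff using d
    by (metis atLeastAtMost_iff order.refl less_imp_le zero_less_one)
  define \<delta> where "\<delta> = min d (e / 2)"
  have "(\<gamma> has_vector_derivative w (\<gamma> t)) (at t within {0..\<delta>})" if t: "t \<in> {0..\<delta>}" for t
  proof -
    have "\<gamma> t \<in> ?B"
      using e(2)[of t] t e(1) by (auto simp: \<delta>_def \<gamma>(1) dist_commute)
    then have "W (\<gamma> t) = w (\<gamma> t)" by (simp add: W_def closest_point_self)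
    then show ?thesis
      using \<gamma>(2)[of t] t has_vector_derivative_within_subset[of \<gamma> "w (\<gamma> t)" t "{0..d}" "{0..\<delta>}"]
      by (auto simp: \<delta>_def)
  qed
  then show thesis using that[of \<delta> \<gamma>] d e(1) \<gamma>(1) by (auto simp: \<delta>_def)
qed

text \<open>No regularity of \<open>\<phi>\<close> is available, so the chain rule does not apply; instead \<open>P\<close>, and
  hence \<open>\<phi> \<circ> P\<close>, is constant along the integral curve of \<open>w\<close>.\<close>

lemma ddir_comp_zero:
  fixes w :: "'a::euclidean_space \<Rightarrow> 'a" and P :: "'a \<Rightarrow> 'b::euclidean_space"
    and \<phi> :: "'b \<Rightarrow> 'c::euclidean_space"
  assumes w: "Ck (Suc 0) w" and P: "\<And>x. P differentiable (at x)"
    and zero: "\<And>x. ddir w P x = 0"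
    and Q: "(\<lambda>x. \<phi> (P x)) differentiable (at x0)"
  shows "ddir w (\<lambda>x. \<phi> (P x)) x0 = 0"
proof -
  obtain \<delta> \<gamma> where \<delta>: "\<delta> > 0" and \<gamma>0: "\<gamma> 0 = x0"
    and \<gamma>: "\<And>t. t \<in> {0..\<delta>} \<Longrightarrow> (\<gamma> has_vector_derivative w (\<gamma> t)) (at t within {0..\<delta>})"
    using local_integral_curve[OF w] by blast
  have chain: "((\<lambda>t. F (\<gamma> t)) has_vector_derivative ddir w F (\<gamma> t)) (at t within {0..\<delta>})"
    if "F differentiable (at (\<gamma> t))" "t \<in> {0..\<delta>}" for F :: "'a \<Rightarrow> 'd::euclidean_space" and t
    using that vector_derivative_diff_chain_within[OF \<gamma>, of t F "frechet_derivative F (at (\<gamma> t))"]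
    by (simp add: o_def ddir_def frechet_derivative_works has_derivative_at_withinI)
  have const: "P (\<gamma> t) = P x0" if "t \<in> {0..\<delta>}" for t
  proof -
    have "((\<lambda>t. P (\<gamma> t)) has_derivative (\<lambda>h. 0)) (at s within {0..\<delta>})" if "s \<in> {0..\<delta>}" for s
      using chain[OF P that] by (simp add: zero has_vector_derivative_def)
    from has_derivative_zero_constant[OF convex_closed_interval this]
    obtain c where "\<And>s. s \<in> {0..\<delta>} \<Longrightarrow> P (\<gamma> s) = c" by blast
    with that \<delta> show ?thesis by (metis \<gamma>0 atLeastAtMost_iff less_imp_le order.refl)
  qed
  \<comment> \<open>The curve exists only for nonnegative times, but a one-sided derivative at the
    end of a nondegenerate interval is unique.\<close>
  have "((\<lambda>t. \<phi> (P (\<gamma> t))) has_vector_derivative ddir w (\<lambda>x. \<phi> (P x)) x0) (at 0 within {0..\<delta>})"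
    using chain[of "\<lambda>x. \<phi> (P x)" 0] Q \<delta> \<gamma>0 by simp
  moreover have "((\<lambda>t. \<phi> (P (\<gamma> t))) has_vector_derivative 0) (at 0 within {0..\<delta>})"
    by (rule has_vector_derivative_transform[of _ _ _ "\<lambda>t. \<phi> (P x0)"]) (use \<delta> in \<open>auto simp: const\<close>)
  ultimately show ?thesis
    using vector_derivative_unique_within_closed_interval[of 0 \<delta> 0] \<delta> by simp
qed

subsection \<open>Lie derivatives of the recursion\<close>

lemma lie_eq_ddir:
  assumes "A differentiable (at x)"
  shows "lie w A x = ddir w A x"
proof -
  have A: "(A has_derivative frechet_derivative A (at x)) (at x)"
    using assms frechet_derivative_works by blast
  have "((\<lambda>y. A y $ i $ j) has_derivative (\<lambda>v. frechet_derivative A (at x) v $ i $ j)) (at x)" for i j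
    by (intro bounded_linear.has_derivative[OF bounded_linear_vec_nth] A)
  from frechet_derivative_at[OF this] show ?thesis
    by (simp add: lie_def ddir_def vec_eq_iff) metis
qed

lemma lie_eq_ddir_fun: "Ck (Suc k) A \<Longrightarrow> lie w A = ddir w A"
  by (rule ext) (rule lie_eq_ddir, rule Ck_differentiable)

lemma smooth_ddir_power: "smooth f \<Longrightarrow> smooth H \<Longrightarrow> smooth ((ddir f ^^ k) H)"
  by (induction k) (auto intro: smooth_ddir)

lemma lie_power_eq_ddir_power:
  assumes "smooth f" "smooth H"
  shows "(lie f ^^ k) H = (ddir f ^^ k) H"
proof (induction k)
  case (Suc k)
  then show ?case
    using smooth_ddir_power[OF assms, of k] by (simp add: smooth_def lie_eq_ddir_fun[of 0] del: Ck.simps)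
qed simp

lemma smooth_ad_power: "smooth f \<Longrightarrow> smooth w \<Longrightarrow> smooth ((lie_bracket f ^^ k) w)"
  by (induction k) (auto intro: smooth_lie_bracket)

section \<open>Eliminating the nonlinear terms of the recursion by iterated brackets\<close>

context
  fixes f w :: "'a::euclidean_space \<Rightarrow> 'a" and P :: "nat \<Rightarrow> 'a \<Rightarrow> 'b::euclidean_space"
    and \<phi> :: "nat \<Rightarrow> 'b \<Rightarrow> 'b" and r :: nat
  assumes f: "smooth f" and w: "smooth w"
    and C: "\<And>i. 1 \<le> i \<Longrightarrow> i \<le> r \<Longrightarrow> Ck (r - i + 1) (P i)"
    and step: "\<And>i x. 1 \<le> i \<Longrightarrow> i < r \<Longrightarrow> P (Suc i) x = ddir f (P i) x + \<phi> i (P i x)"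
    and zero: "\<And>i x. 1 \<le> i \<Longrightarrow> i < r \<Longrightarrow> ddir w (P i) x = 0"
begin

private abbreviation "ad k \<equiv> (lie_bracket f ^^ k) w"

private lemma ad_C1: "Ck (Suc 0) (ad k)"
  using smooth_ad_power[OF f w] by (simp add: smooth_def del: Ck.simps)

private lemma f_C1: "Ck (Suc 0) f"
  using f by (simp add: smooth_def del: Ck.simps)

private lemma P_C1: "1 \<le> i \<Longrightarrow> i \<le> r \<Longrightarrow> Ck (Suc 0) (P i)"
  by (rule Ck_le[OF _ C]) auto

private lemma P_C2: "1 \<le> i \<Longrightarrow> i < r \<Longrightarrow> Ck (Suc (Suc 0)) (P i)"
  by (rule Ck_le[OF _ C]) auto

text \<open>A field that annihilates \<open>P i\<close> everywhere also annihilates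
  \<open>\<phi> i\<close> composed with \<open>P i\<close>, so only the drift part of the recursion
  is left.\<close>

lemma ddir_recursion_step:
  assumes i: "1 \<le> i" "i < r" and W: "Ck (Suc 0) W" and W0: "\<And>x. ddir W (P i) x = 0"
  shows "ddir W (P (Suc i)) x = ddir W (ddir f (P i)) x"
proof -
  have d: "P (Suc i) differentiable (at x)" "ddir f (P i) differentiable (at x)" "P i differentiable (at x)" for x
    using Ck_differentiable[OF P_C1] Ck_differentiable[OF Ck_ddir[OF P_C2[OF i] f_C1]] i
    by auto
  \<comment> \<open>Differentiability of the composite is read off from this difference, as
    \<open>\<phi> i\<close> itself has no known regularity.\<close>
  have \<phi>: "(\<lambda>x. \<phi> i (P i x)) = (\<lambda>x. P (Suc i) x - ddir f (P i) x)"
    using step[OF i] by auto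
  have "ddir W (\<lambda>x. \<phi> i (P i x)) x = 0"
  proof (rule ddir_comp_zero[where \<phi> = "\<phi> i" and P = "P i", OF W d(3) W0])
    show "(\<lambda>x. \<phi> i (P i x)) differentiable (at x)" unfolding \<phi> by (intro differentiable_diff d)
  qed
  then show ?thesis using ddir_diff[OF d(1,2)] by (simp add: \<phi>)
qed

text \<open>By the commutator formula one more bracket at level \<open>i\<close> amounts, up to
  sign, to one bracket fewer at level \<open>Suc i\<close>, the remaining term being the derivative
  of a map that vanishes identically.\<close>

lemma ddir_ad_recursion_zero: "1 \<le> i \<Longrightarrow> i + k < r \<Longrightarrow> ddir (ad k) (P i) x = 0"
proof (induction k arbitrary: i x)
  case 0
  then show ?case by (simp add: zero)
next
  case (Suc k)
  then have i: "1 \<le> i" "i < r" by auto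
  have z: "ddir (ad k) (P i) = (\<lambda>x. 0)" using Suc by auto
  have "ddir (ad (Suc k)) (P i) x = ddir f (ddir (ad k) (P i)) x - ddir (ad k) (ddir f (P i)) x"
    using ddir_commutator[OF P_C2[OF i] f_C1 ad_C1, of k x] by simp
  also have "\<dots> = - ddir (ad k) (P (Suc i)) x"
    using ddir_recursion_step[OF i ad_C1] z by (simp add: ddir_zero)
  also have "\<dots> = 0" using Suc by simp
  finally show ?case .
qed

text \<open>\<open>P i\<close> and the iterated derivative without nonlinear terms satisfy the same
  commutator relation. Raising \<open>i\<close> by one calls on the previous level for both
  \<open>k\<close> and \<open>Suc k\<close>, hence the induction with \<open>k\<close> arbitrary and
  the bound on \<open>i + k\<close>. The case of interest is \<open>k = 0\<close>,
  \<open>i = r\<close>.\<close>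

lemma ddir_ad_recursion:
  assumes P1: "smooth (P 1)"
  shows "1 \<le> i \<Longrightarrow> i + k \<le> r \<Longrightarrow> ddir (ad k) (P i) x = ddir (ad k) ((ddir f ^^ (i - 1)) (P 1)) x"
proof (induction i arbitrary: k x rule: nat_induct_at_least)
  case base
  then show ?case by simp
next
  case (Suc i)
  let ?Q = "(ddir f ^^ (i - 1)) (P 1)"
  have i: "1 \<le> i" "i < r" using Suc by auto
  have Q: "Ck (Suc (Suc 0)) ?Q"
    using smooth_ddir_power[OF f P1] by (simp add: smooth_def del: Ck.simps)
  have Q': "(ddir f ^^ (Suc i - 1)) (P 1) = ddir f ?Q"
    using i by (cases i) auto
  have "ddir (ad k) (P (Suc i)) x = ddir (ad k) (ddir f (P i)) x"
    using Suc by (intro ddir_recursion_step i ad_C1 ddir_ad_recursion_zero) auto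
  also have "\<dots> = ddir f (ddir (ad k) (P i)) x - ddir (ad (Suc k)) (P i) x"
    using ddir_commutator[OF P_C2[OF i] f_C1 ad_C1, of k x] by simp
  also have "ddir (ad k) (P i) = ddir (ad k) ?Q"
    using Suc.IH[of k] Suc.prems by auto
  also have "ddir (ad (Suc k)) (P i) x = ddir (ad (Suc k)) ?Q x"
    using Suc.IH[of "Suc k"] Suc.prems by simp
  also have "ddir f (ddir (ad k) ?Q) x - ddir (ad (Suc k)) ?Q x = ddir (ad k) (ddir f ?Q) x"
    using ddir_commutator[OF Q f_C1 ad_C1, of k x] by simp
  finally show ?case by (simp only: Q')
qed

end

lemma Psi_step:
  assumes "Ck (Suc k) (Psi f \<alpha> H i)" "1 \<le> i"
  shows "Psi f \<alpha> H (Suc i) x = ddir f (Psi f \<alpha> H i) x + spectral_map (\<alpha> i) (Psi f \<alpha> H i x)"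
  using lie_eq_ddir_fun[OF assms(1), of f] assms(2) by (cases i) simp_all

text \<open>Connects the relative degree condition, phrased with iterated Lie derivatives of
  \<open>H\<close>, to the input term of \<open>Psi_dot\<close>. The vanishing required below level
  \<open>r\<close> comes from \<open>first_control_level\<close>.\<close>

lemma lie_g_Psi:
  fixes g :: "real^'n \<Rightarrow> real^'m^'n"
  assumes f: "smooth f" and g: "smooth g" and H: "smooth H"
    and C: "\<And>i. i \<in> {1..r} \<Longrightarrow> Ck (r - i + 1) (Psi f \<alpha> H i)"
    and lvl: "first_control_level f g \<alpha> H r"
  shows "lie (\<lambda>y. column j (g y)) (Psi f \<alpha> H r) x = lie (\<lambda>y. column j (g y)) ((lie f ^^ (r - 1)) H) x"
proof -
  let ?w = "\<lambda>y. column j (g y)" and ?P = "Psi f \<alpha> H"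
  have r: "1 \<le> r" using lvl by (simp add: first_control_level_def)
  have "bounded_linear (\<lambda>M :: real^'m^'n. column j M)"
    by (intro linear_conv_bounded_linear[THEN iffD1] linearI) (auto simp: column_def vec_eq_iff)
  from Ck_bounded_linear[OF this, of _ g] have w: "smooth ?w"
    using g by (simp add: smooth_def del: Ck.simps)
  have C1: "Ck (Suc 0) (?P i)" if "1 \<le> i" "i \<le> r" for i
    using C[of i] that by (intro Ck_le[OF _ C]) auto
  have z: "ddir ?w (?P i) x = 0" if "1 \<le> i" "i < r" for i x
  proof -
    have "lie ?w (?P i) x = 0" using lvl that unfolding first_control_level_def by force
    then show ?thesis using that lie_eq_ddir_fun[OF C1[of i], of ?w] by simp
  qed
  have C': "Ck (r - i + 1) (?P i)" if "1 \<le> i" "i \<le> r" for i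
    using C that by simp
  have step: "?P (Suc i) x = ddir f (?P i) x + spectral_map (\<alpha> i) (?P i x)" if "1 \<le> i" "i < r" for i x
    by (rule Psi_step[OF C1]) (use that in auto)
  have P1: "smooth (?P 1)" using H by simp
  have "ddir ?w (?P r) x = ddir ?w ((ddir f ^^ (r - 1)) H) x"
    using ddir_ad_recursion[OF f w C' step z P1 r, of 0 x] by simp
  moreover have "lie ?w (?P r) = ddir ?w (?P r)" using C1[OF r order.refl] by (rule lie_eq_ddir_fun)
  moreover have "lie ?w ((lie f ^^ (r - 1)) H) = ddir ?w ((ddir f ^^ (r - 1)) H)"
    using smooth_ddir_power[OF f H, of "r - 1"]
    by (simp add: lie_power_eq_ddir_power[OF f H] smooth_def lie_eq_ddir_fun[of 0] del: Ck.simps)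
  ultimately show ?thesis by simp
qed

subsection \<open>Positive definite matrices\<close>

lemma matrix_vector_bounded_bilinear: "bounded_bilinear ((*v) :: real^'n^'m \<Rightarrow> _)"
proof -
  have "bilinear ((*v) :: real^'n^'m \<Rightarrow> _)"
    unfolding bilinear_def
    by (auto intro!: linearI simp: matrix_vector_mult_add_rdistrib matrix_vector_right_distrib
        scaleR_matrix_vector_assoc matrix_vector_mult_scaleR)
  then show ?thesis by (simp add: bilinear_conv_bounded_bilinear)
qed

lemma transpose_add: "transpose (A + B) = transpose A + transpose B"
  and transpose_scaleR: "transpose (c *\<^sub>R A) = c *\<^sub>R transpose (A :: real^'n^'m)"
  by (simp_all add: transpose_def vec_eq_iff)

lemma pos_semidef_add: "pos_semidef A \<Longrightarrow> pos_semidef B \<Longrightarrow> pos_semidef (A + B)"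
  by (simp add: pos_semidef_def transpose_add matrix_vector_mult_add_rdistrib inner_add_right)

lemma pos_semidef_scaleR: "pos_semidef A \<Longrightarrow> 0 \<le> c \<Longrightarrow> pos_semidef (c *\<^sub>R A)"
  by (simp add: pos_semidef_def transpose_scaleR scaleR_matrix_vector_assoc[symmetric])

lemma pos_def_imp_pos_semidef: "pos_def A \<Longrightarrow> pos_semidef A"
  unfolding pos_def_def pos_semidef_def by (metis inner_zero_left less_imp_le order.refl)

lemma pos_def_add_pos_semidef: "pos_def A \<Longrightarrow> pos_semidef B \<Longrightarrow> pos_def (A + B)"
  by (auto simp: pos_def_def pos_semidef_def transpose_add matrix_vector_mult_add_rdistrib
      inner_add_right intro: add_pos_nonneg)

lemma pos_def_scaleR: "pos_def A \<Longrightarrow> 0 < c \<Longrightarrow> pos_def (c *\<^sub>R A)"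
  by (simp add: pos_def_def transpose_scaleR scaleR_matrix_vector_assoc[symmetric])

lemma quadratic_form_normalize:
  fixes A :: "real^'p^'p"
  shows "v \<noteq> 0 \<Longrightarrow> v \<bullet> (A *v v) = (norm v)\<^sup>2 * ((v /\<^sub>R norm v) \<bullet> (A *v (v /\<^sub>R norm v)))"
  by (simp add: matrix_vector_mult_scaleR power2_eq_square field_simps)

lemma pos_def_iff_sphere:
  fixes A :: "real^'p^'p"
  shows "pos_def A \<longleftrightarrow> transpose A = A \<and> (\<forall>v\<in>sphere 0 1. 0 < v \<bullet> (A *v v))"
proof -
  have "0 < v \<bullet> (A *v v)" if "\<forall>v\<in>sphere 0 1. 0 < v \<bullet> (A *v v)" "v \<noteq> 0" for v
    by (subst quadratic_form_normalize[OF that(2)]) (use that in \<open>auto intro!: mult_pos_pos simp del: inner_scaleR_left\<close>)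
  moreover have "v \<noteq> 0" if "v \<in> sphere 0 1" for v :: "real^'p" using that by auto
  ultimately show ?thesis unfolding pos_def_def by blast
qed

text \<open>On the unit sphere the form of \<open>A\<close> has a positive minimum \<open>c\<close>,
  which a perturbation of norm below \<open>c / K\<close> cannot cancel. The filter is general
  because the lemma serves both neighbourhoods in state space and difference quotients in
  time.\<close>

lemma pos_def_eventually:
  fixes A :: "real^'p^'p"
  assumes A: "pos_def A" and lim: "(M \<longlongrightarrow> A) F"
    and sym: "\<And>x. transpose (M x) = M x"
  shows "\<forall>\<^sub>F x in F. pos_def (M x)"
proof -
  obtain K where K: "K > 0" "\<And>(B::real^'p^'p) v. norm (B *v v) \<le> norm B * norm v * K"
    using bounded_bilinear.pos_bounded[OF matrix_vector_bounded_bilinear] by blast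
  obtain v0 where "v0 \<in> sphere 0 1" and
    min: "\<And>v. v \<in> sphere 0 1 \<Longrightarrow> v0 \<bullet> (A *v v0) \<le> v \<bullet> (A *v v)"
    using continuous_attains_inf[OF compact_sphere _ continuous_on_quadratic_form, of 0 1 A] by auto
  define c where "c = v0 \<bullet> (A *v v0)"
  have c: "c > 0" using \<open>v0 \<in> sphere 0 1\<close> A by (simp add: c_def pos_def_iff_sphere)
  have "\<forall>\<^sub>F x in F. dist (M x) A < c / K"
    using lim c K by (intro tendstoD) auto
  then show ?thesis
  proof eventually_elim
    case (elim x)
    have "0 < v \<bullet> (M x *v v)" if v: "v \<in> sphere 0 1" for v
    proof -
      have "\<bar>v \<bullet> ((M x - A) *v v)\<bar> \<le> norm v * norm ((M x - A) *v v)"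
        by (rule Cauchy_Schwarz_ineq2)
      also have "\<dots> \<le> norm (M x - A) * K" using v K(2)[of "M x - A" v] by simp
      also have "\<dots> < c" using elim K(1) by (simp add: dist_norm field_simps)
      finally show ?thesis
        using min[OF v] by (simp add: c_def matrix_vector_mult_diff_rdistrib inner_diff_right)
    qed
    then show ?case using sym by (simp add: pos_def_iff_sphere)
  qed
qed

lemma open_pos_def:
  fixes M :: "'a::topological_space \<Rightarrow> real^'p^'p"
  assumes "continuous_on UNIV M" and sym: "\<And>x. transpose (M x) = M x"
  shows "open {x. pos_def (M x)}"
proof (subst open_subopen, safe)
  fix x assume "pos_def (M x)"
  moreover have "(M \<longlongrightarrow> M x) (nhds x)"
    using assms(1) by (simp add: continuous_on_def tendsto_at_iff_tendsto_nhds)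
  ultimately have "\<forall>\<^sub>F y in nhds x. pos_def (M y)" using sym by (rule pos_def_eventually)
  then show "\<exists>T. open T \<and> x \<in> T \<and> T \<subseteq> {x. pos_def (M x)}"
    by (auto simp: eventually_nhds)
qed

lemma closed_pos_semidef:
  fixes M :: "'a::topological_space \<Rightarrow> real^'p^'p"
  assumes "continuous_on UNIV M" and sym: "\<And>x. transpose (M x) = M x"
  shows "closed {x. pos_semidef (M x)}"
proof -
  have "{x. pos_semidef (M x)} = (\<Inter>v. {x. 0 \<le> v \<bullet> (M x *v v)})"
    by (auto simp: pos_semidef_def sym)
  moreover have "closed {x. 0 \<le> v \<bullet> (M x *v v)}" for v
    by (intro closed_Collect_le continuous_intros assms
        bounded_bilinear.continuous_on[OF matrix_vector_bounded_bilinear])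
  ultimately show ?thesis by auto
qed

text \<open>The sets \<open>C n\<close> on which the weight \<open>n\<close> fails are compact and
  decrease with \<open>n\<close>. Their intersection is empty: where \<open>b\<close> is positive a
  large weight succeeds, and where it vanishes \<open>a\<close> is already positive. Hence some
  \<open>C n\<close> is empty.\<close>

lemma compact_penalty:
  fixes a b :: "'a::heine_borel \<Rightarrow> real"
  assumes K: "compact K" and a: "continuous_on K a" and b: "continuous_on K b"
    and nn: "\<And>v. v \<in> K \<Longrightarrow> 0 \<le> b v" and pos: "\<And>v. v \<in> K \<Longrightarrow> b v = 0 \<Longrightarrow> 0 < a v"
  obtains \<omega> where "0 \<le> \<omega>" "\<And>v. v \<in> K \<Longrightarrow> 0 < a v + \<omega> * b v"
proof -
  define C where "C n = {v \<in> K. a v + real n * b v \<le> 0}" for n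
  have "compact (C n)" for n
  proof -
    have "continuous_on K (\<lambda>v. a v + real n * b v)" by (intro continuous_intros a b)
    then have "closed (K \<inter> (\<lambda>v. a v + real n * b v) -` {..0})"
      by (rule continuous_closed_preimage[OF _ compact_imp_closed[OF K] closed_atMost])
    moreover have "C n = K \<inter> (K \<inter> (\<lambda>v. a v + real n * b v) -` {..0})" by (auto simp: C_def)
    ultimately show ?thesis using K by (metis compact_Int_closed)
  qed
  moreover have "C n \<subseteq> C m" if "m \<le> n" for m n
    using nn that by (auto simp: C_def) (smt (verit) mult_right_mono of_nat_mono)
  moreover have "\<Inter>(range C) = {}"
  proof safe
    fix v assume v: "v \<in> \<Inter>(range C)"
    then have vK: "v \<in> K" and le: "\<And>n. a v + real n * b v \<le> 0" by (auto simp: C_def)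
    have "b v > 0" using nn[OF vK] pos[OF vK] le[of 0] by force
    then obtain n where "- a v < real n * b v" using reals_Archimedean3 by blast
    with le[of n] show "v \<in> {}" by simp
  qed
  ultimately obtain n where "C n = {}" using compact_nest[of C] by blast
  then show thesis by (intro that[of "real n"]) (force simp: C_def)+
qed

text \<open>Finsler's lemma: the zeros of a semidefinite form are exactly its kernel, so the compact
  penalty applies on the unit sphere.\<close>

lemma pos_def_penalty:
  fixes A N :: "real^'p^'p"
  assumes A: "pos_semidef A" and N: "transpose N = N"
    and ker: "\<And>v. v \<noteq> 0 \<Longrightarrow> A *v v = 0 \<Longrightarrow> 0 < v \<bullet> (N *v v)"
  obtains \<omega> where "0 \<le> \<omega>" "pos_def (N + \<omega> *\<^sub>R A)"
proof -
  obtain \<omega> where "0 \<le> \<omega>" "\<And>v. v \<in> sphere 0 1 \<Longrightarrow> 0 < v \<bullet> (N *v v) + \<omega> * (v \<bullet> (A *v v))"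
  proof (rule compact_penalty[OF compact_sphere continuous_on_quadratic_form continuous_on_quadratic_form])
    fix v :: "real^'p" assume "v \<in> sphere 0 1"
    then have "v \<noteq> 0" by auto
    then show "0 \<le> v \<bullet> (A *v v)" "v \<bullet> (A *v v) = 0 \<Longrightarrow> 0 < v \<bullet> (N *v v)"
      using A pos_semidef_null[OF A] ker[of v] by (auto simp: pos_semidef_def)
  qed blast
  then show thesis
    using A N by (intro that[of \<omega>]) (auto simp: pos_def_iff_sphere pos_semidef_def transpose_add
        transpose_scaleR matrix_vector_mult_add_rdistrib scaleR_matrix_vector_assoc[symmetric] inner_add_right)
qed

text \<open>Identifies the eigenspace in the relative degree condition with the kernel at a singular
  semidefinite matrix: a zero of the form is a kernel vector, and no eigenvalue is negative.\<close>

lemma min_eigenvalue_degenerate: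
  assumes A: "pos_semidef A" and nA: "\<not> pos_def A"
  shows "min_eigenvalue A = 0"
  unfolding min_eigenvalue_def
proof (rule Least_equality)
  obtain v where v: "v \<noteq> 0" "v \<bullet> (A *v v) = 0"
    using A nA by (auto simp: pos_semidef_def pos_def_def) (metis order_le_less)
  with pos_semidef_null[OF A] show "is_eigenvalue A 0"
    by (auto simp: is_eigenvalue_def eigenspace_def)
next
  fix l assume "is_eigenvalue A l"
  then obtain v where v: "v \<noteq> 0" "A *v v = l *\<^sub>R v" by (auto simp: is_eigenvalue_def eigenspace_def)
  have "0 \<le> v \<bullet> (A *v v)" using A by (simp add: pos_semidef_def)
  moreover have "0 < v \<bullet> v" using v by simp
  ultimately show "0 \<le> l" using v by (simp add: zero_le_mult_iff del: inner_gt_zero_iff)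
qed

lemma pos_def_upto_imp_pos_on_span:
  fixes M :: "real^'p^'p"
  assumes V: "orthonormal_basis_of q V E" and pd: "pos_def_upto q (\<lambda>a b. V a \<bullet> (M *v V b))"
    and v: "v \<in> E" "v \<noteq> 0"
  shows "0 < v \<bullet> (M *v v)"
proof -
  \<comment> \<open>\<open>span\<close> provides coefficients on the set of basis vectors, whereas
    the matrix form sums over indices.\<close>
  have inj: "inj_on V {..<q}"
  proof
    fix a b assume "a \<in> {..<q}" "b \<in> {..<q}" "V a = V b"
    with V show "a = b" unfolding orthonormal_basis_of_def by (metis lessThan_iff zero_neq_one)
  qed
  obtain u where "v = (\<Sum>w\<in>V ` {..<q}. u w *\<^sub>R w)"
    using V v by (auto simp: orthonormal_basis_of_def span_finite)
  then have v_eq: "v = (\<Sum>a<q. u (V a) *\<^sub>R V a)" by (simp add: sum.reindex[OF inj])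
  have "\<exists>a<q. u (V a) \<noteq> 0"
  proof (rule ccontr)
    assume "\<not> ?thesis"
    then have "v = 0" by (subst v_eq) (auto intro!: sum.neutral)
    with v show False by simp
  qed
  moreover have "v \<bullet> (M *v v) = (\<Sum>a<q. \<Sum>b<q. u (V a) * (V a \<bullet> (M *v V b)) * u (V b))"
  proof -
    have "M *v v = (\<Sum>b<q. u (V b) *\<^sub>R (M *v V b))"
      by (subst v_eq) (simp add: matrix_vector_mult_scaleR linear_sum[OF matrix_vector_mul_linear])
    then show ?thesis
      by (subst v_eq, simp add: inner_sum_left inner_sum_right mult_ac sum_distrib_left,
          subst sum.swap, simp add: mult_ac)
  qed
  ultimately show ?thesis using pd by (auto simp: pos_def_upto_def dest!: spec[of _ "\<lambda>a. u (V a)"])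
qed

subsection \<open>Selection, viability and comparison\<close>

text \<open>By \<open>lsc\<close> a single value stays admissible on a whole neighbourhood, so
  constants can be chosen locally; convexity keeps their averages under a partition of unity
  admissible. Closedness of \<open>S\<close> allows the extension to the whole space.\<close>

lemma continuous_selection_open_fibres:
  fixes S :: "'a::euclidean_space set" and K :: "'a \<Rightarrow> 'b::euclidean_space set"
  assumes S: "closed S" and conv: "\<And>x. x \<in> S \<Longrightarrow> convex (K x)"
    and ne: "\<And>x. x \<in> S \<Longrightarrow> K x \<noteq> {}"
    and lsc: "\<And>x u. x \<in> S \<Longrightarrow> u \<in> K x \<Longrightarrow> \<exists>T. open T \<and> x \<in> T \<and> (\<forall>y\<in>T \<inter> S. u \<in> K y)"
  obtains k where "continuous_on UNIV k" "\<And>x. x \<in> S \<Longrightarrow> k x \<in> K x"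
proof -
  define \<C> where "\<C> = {T. open T \<and> (\<exists>u. \<forall>y\<in>T \<inter> S. u \<in> K y)}"
  have cover: "S \<subseteq> \<Union>\<C>"
  proof
    fix x assume x: "x \<in> S"
    then obtain u where "u \<in> K x" using ne by blast
    from lsc[OF x this] obtain T where "open T" "x \<in> T" "\<forall>y\<in>T \<inter> S. u \<in> K y" by blast
    then have "T \<in> \<C>" by (auto simp: \<C>_def)
    with \<open>x \<in> T\<close> show "x \<in> \<Union>\<C>" by (rule UnionI[rotated])
  qed
  have opC: "\<And>T. T \<in> \<C> \<Longrightarrow> open T" by (simp add: \<C>_def)
  obtain \<D> where D: "S \<subseteq> \<Union>\<D>" "\<And>U. U \<in> \<D> \<Longrightarrow> open U \<and> (\<exists>T. T \<in> \<C> \<and> U \<subseteq> T)"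
    "\<And>x. x \<in> S \<Longrightarrow> \<exists>V. open V \<and> x \<in> V \<and> finite {U. U \<in> \<D> \<and> (U \<inter> V \<noteq> {})}"
    by (rule paracompact[OF cover opC]) (assumption, rule that)
  have "\<exists>u. \<forall>y\<in>U \<inter> S. u \<in> K y" if U: "U \<in> \<D>" for U
  proof -
    obtain T where "T \<in> \<C>" "U \<subseteq> T" using D(2)[OF U] by blast
    moreover from this(1) obtain u where "\<forall>y\<in>T \<inter> S. u \<in> K y" by (auto simp: \<C>_def)
    ultimately have "\<forall>y\<in>U \<inter> S. u \<in> K y" by auto
    then show ?thesis ..
  qed
  then obtain c where c: "\<And>U y. U \<in> \<D> \<Longrightarrow> y \<in> U \<Longrightarrow> y \<in> S \<Longrightarrow> c U \<in> K y"
    by (metis IntI)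
  have opD: "\<And>U. U \<in> \<D> \<Longrightarrow> open U" using D(2) by blast
  obtain F :: "['a set, 'a] \<Rightarrow> real"
    where F1: "\<And>U. U \<in> \<D> \<Longrightarrow> continuous_on S (F U) \<and> (\<forall>x \<in> S. 0 \<le> F U x)"
      and F2: "\<And>x U. \<lbrakk>U \<in> \<D>; x \<in> S; x \<notin> U\<rbrakk> \<Longrightarrow> F U x = 0"
      and F3: "\<And>x. x \<in> S \<Longrightarrow> supp_sum (\<lambda>W. F W x) \<D> = 1"
      and F4: "\<And>x. x \<in> S \<Longrightarrow> \<exists>V. open V \<and> x \<in> V \<and> finite {U \<in> \<D>. \<exists>x\<in>V. F U x \<noteq> 0}"
    using subordinate_partition_of_unity[OF D(1) opD D(3)] by blast
  define I where "I x = {U \<in> \<D>. F U x \<noteq> 0}" for x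
  define h where "h x = (\<Sum>U\<in>I x. F U x *\<^sub>R c U)" for x
  have "continuous_on S h"
    unfolding continuous_on_eq_continuous_within
  proof
    fix x assume x: "x \<in> S"
    from F4[OF this] obtain V where V: "open V" "x \<in> V" and fin: "finite {U \<in> \<D>. \<exists>x\<in>V. F U x \<noteq> 0}"
      (is "finite ?Z") by blast
    \<comment> \<open>The index set \<open>I y\<close> varies with \<open>y\<close>; on
      \<open>V\<close> it is replaced by one fixed finite set, which only adds zero terms.\<close>
    have "continuous_on (S \<inter> V) (\<lambda>y. \<Sum>U\<in>?Z. F U y *\<^sub>R c U)"
      by (intro continuous_intros) (use F1 in \<open>auto intro: continuous_on_subset\<close>)
    moreover have "(\<Sum>U\<in>?Z. F U y *\<^sub>R c U) = h y" if "y \<in> S \<inter> V" for y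
      unfolding h_def I_def using that by (intro sum.mono_neutral_right fin) auto
    ultimately have "continuous_on (S \<inter> V) h" by (rule continuous_on_eq)
    with x V(2) have "continuous (at x within S \<inter> V) h" by (auto simp: continuous_on_eq_continuous_within)
    then show "continuous (at x within S) h"
      using at_within_nhd[OF V(2,1), of S "S \<inter> V"] by auto
  qed
  moreover have "h x \<in> K x" if x: "x \<in> S" for x
    unfolding h_def
  proof (rule convex_sum[OF _ conv[OF x]])
    from F4[OF x] obtain V where "x \<in> V" and fin: "finite {U \<in> \<D>. \<exists>x\<in>V. F U x \<noteq> 0}" by blast
    then show "finite (I x)" by (auto simp: I_def elim!: rev_finite_subset)
    show "(\<Sum>U\<in>I x. F U x) = 1" using F3[OF x] by (simp add: supp_sum_def support_on_def I_def)
    show "0 \<le> F U x" "c U \<in> K x" if "U \<in> I x" for U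
      using that F1 F2[of U x] c[of U x] x by (auto simp: I_def)
  qed
  moreover obtain k where "continuous_on UNIV k" "\<And>x. x \<in> S \<Longrightarrow> k x = h x"
    using Tietze_unbounded[OF \<open>continuous_on S h\<close>, of UNIV] S by auto
  ultimately show thesis using that[of k] by simp
qed

text \<open>Let \<open>m\<close> be the supremum of the times up to which the path has stayed in
  \<open>S\<close>. Closedness puts the path in \<open>S\<close> at \<open>m\<close>, and
  \<open>step\<close> would carry it beyond \<open>m\<close> if \<open>m < b\<close>.\<close>

lemma stays_in_closed_set:
  fixes x :: "real \<Rightarrow> 'a::topological_space"
  assumes ab: "a \<le> b" and cont: "continuous_on {a..b} x" and S: "closed S" and a: "x a \<in> S"
    and step: "\<And>t. a \<le> t \<Longrightarrow> t < b \<Longrightarrow> x t \<in> S \<Longrightarrow> \<exists>\<delta>>0. \<forall>s\<in>{t..t+\<delta>} \<inter> {a..b}. x s \<in> S"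
  shows "x b \<in> S"
proof -
  define T where "T = {t \<in> {a..b}. \<forall>s\<in>{a..t}. x s \<in> S}"
  define m where "m = Sup T"
  have aT: "a \<in> T" using a ab by (auto simp: T_def)
  have bdd: "bdd_above T" by (auto simp: T_def intro: bdd_aboveI[of _ b])
  have m: "a \<le> m" "m \<le> b"
  proof -
    show "a \<le> m" unfolding m_def by (rule cSup_upper[OF aT bdd])
    show "m \<le> b" unfolding m_def by (rule cSup_least) (use aT in \<open>auto simp: T_def\<close>)
  qed
  have below: "x s \<in> S" if s: "a \<le> s" "s < m" for s
  proof -
    obtain t where "t \<in> T" "s < t" using less_cSupD[of T s] aT s(2) unfolding m_def by blast
    with s(1) show ?thesis by (simp add: T_def)
  qed
  have cl: "closed ({a..b} \<inter> x -` S)" by (rule continuous_closed_preimage[OF cont _ S]) simp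
  have "m \<in> {a..b} \<inter> x -` S"
  proof (cases "a = m")
    case False
    then have "closure {a<..<m} = {a..m}" using m by simp
    moreover have "closure {a<..<m} \<subseteq> {a..b} \<inter> x -` S"
      using below m cl by (intro closure_minimal) auto
    ultimately show ?thesis using m by auto
  qed (use a ab in auto)
  then have xm: "x m \<in> S" by simp
  show ?thesis
  proof (cases "m = b")
    case False
    with m have "m < b" by simp
    from step[OF m(1) this xm] obtain \<delta> where \<delta>: "\<delta> > 0" "\<forall>s\<in>{m..m+\<delta>} \<inter> {a..b}. x s \<in> S" by blast
    have "min (m + \<delta>) b \<in> T"
      using m \<delta> below by (auto simp: T_def)
    from cSup_upper[OF this bdd] show ?thesis using \<delta> \<open>m < b\<close> by (simp add: m_def)
  qed (use xm in simp)
qed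

section \<open>Semidefiniteness along matrix-valued curves\<close>

lemma class_Ke_neg: "class_Ke \<alpha> \<Longrightarrow> l < 0 \<Longrightarrow> \<alpha> l < 0"
  unfolding class_Ke_def by (metis strict_monoD)

text \<open>At a negative minimum of \<open>v \<bullet> (P t *v v)\<close> over times and unit vectors, \<open>v\<close> is an
  eigenvector of \<open>P t\<close>, so the comparison term makes this quantity strictly increasing in time, and
  it was smaller shortly before.\<close>

lemma pos_semidef_comparison:
  fixes P R :: "real \<Rightarrow> real^'p^'p"
  assumes \<alpha>: "class_Ke \<alpha>"
    and der: "\<And>t. t \<in> {a..b} \<Longrightarrow>
      (P has_vector_derivative (R t - spectral_map \<alpha> (P t))) (at t within {a..b})"
    and R: "\<And>t. t \<in> {a..b} \<Longrightarrow> pos_semidef (R t)"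
    and sym: "\<And>t. transpose (P t) = P t"
    and Pa: "pos_semidef (P a)" and t: "t \<in> {a..b}"
  shows "pos_semidef (P t)"
proof (rule ccontr)
  assume "\<not> pos_semidef (P t)"
  then obtain v where "v \<bullet> (P t *v v) < 0" by (auto simp: pos_semidef_def sym not_le)
  moreover from this have "v \<noteq> 0" by auto
  ultimately have neg: "(v /\<^sub>R norm v) \<bullet> (P t *v (v /\<^sub>R norm v)) < 0"
    using quadratic_form_normalize[of v "P t"] by (smt (verit) zero_le_mult_iff zero_le_power2)
  let ?K = "{a..b} \<times> sphere (0::real^'p) 1"
  let ?F = "\<lambda>z. snd z \<bullet> (P (fst z) *v snd z)"
  have contP: "continuous_on {a..b} P"
    using der has_vector_derivative_continuous by (metis continuous_on_eq_continuous_within)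
  have "continuous_on ?K ?F"
    by (intro continuous_intros bounded_bilinear.continuous_on[OF matrix_vector_bounded_bilinear]
        continuous_on_compose2[OF contP]) auto
  moreover have mem: "(t, v /\<^sub>R norm v) \<in> ?K" using t \<open>v \<noteq> 0\<close> by simp
  ultimately obtain z where z: "z \<in> ?K" "\<And>y. y \<in> ?K \<Longrightarrow> ?F z \<le> ?F y"
    using continuous_attains_inf[OF compact_Times[OF compact_Icc compact_sphere], of a b 0 1 ?F]
    by blast
  obtain s w where sw: "z = (s, w)" by (cases z)
  define l where "l = w \<bullet> (P s *v w)"
  have s: "s \<in> {a..b}" and w: "norm w = 1" using z(1) sw by auto
  have l: "l < 0" using z(2)[OF mem] neg by (simp add: sw l_def)
  have eig: "P s *v w = l *\<^sub>R w"
    unfolding l_def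
    by (rule rayleigh_min_eigenvector[OF sym subspace_UNIV])
       (use z(2)[of "(s, _)"] sw s w in auto)
  let ?D = "w \<bullet> ((R s - spectral_map \<alpha> (P s)) *v w)"
  have "bounded_linear (\<lambda>M :: real^'p^'p. w \<bullet> (M *v w))"
    by (intro bounded_linear_compose[OF bounded_linear_inner_right]
        bounded_bilinear.bounded_linear_left[OF matrix_vector_bounded_bilinear])
  from bounded_linear.has_vector_derivative[OF this der[OF s]]
  have "((\<lambda>t. w \<bullet> (P t *v w)) has_real_derivative ?D) (at s within {a..b})"
    by (simp add: has_real_derivative_iff_has_vector_derivative)
  \<comment> \<open>On the eigenvector \<open>w\<close> the spectral term has the value
    \<open>\<alpha> l < 0\<close> and enters with a minus sign, while \<open>R s\<close> contributes
    a nonnegative amount.\<close>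
  moreover have "?D > 0"
    using R[OF s] class_Ke_neg[OF \<alpha> l] w
    by (simp add: matrix_vector_mult_diff_rdistrib spectral_map_eigenvector[OF sym eig]
        inner_diff_right pos_semidef_def norm_eq_1) (smt (verit))
  ultimately obtain d where d: "d > 0" "\<And>h. h > 0 \<Longrightarrow> s - h \<in> {a..b} \<Longrightarrow> h < d \<Longrightarrow>
      w \<bullet> (P (s - h) *v w) < w \<bullet> (P s *v w)"
    using has_real_derivative_pos_inc_left by blast
  \<comment> \<open>The form is nonnegative at the initial time, so there is room to step back from
    \<open>s\<close> inside the interval and contradict minimality.\<close>
  have "s \<noteq> a" using Pa l by (auto simp: pos_semidef_def l_def not_less[symmetric])
  define h where "h = min (d / 2) (s - a)"
  have h: "h > 0" "s - h \<in> {a..b}" "h < d" using d(1) s \<open>s \<noteq> a\<close> by (auto simp: h_def)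
  from d(2)[OF h] z(2)[of "(s - h, w)"] h(2) w show False by (simp add: sw)
qed

text \<open>With \<open>M t\<close> tending to \<open>D + \<omega> *\<^sub>R P a\<close>, the matrix
  \<open>P t\<close> is \<open>P a\<close> scaled by \<open>1 - (t - a) * \<omega>\<close> plus
  \<open>M t\<close> scaled by \<open>t - a\<close>. For small times both coefficients are
  nonnegative and \<open>M t\<close> is definite.\<close>

lemma pos_semidef_short_time:
  fixes P :: "real \<Rightarrow> real^'p^'p"
  assumes der: "(P has_vector_derivative D) (at a within {a..b})" and ab: "a < b"
    and Pa: "pos_semidef (P a)" and sym: "\<And>t. transpose (P t) = P t"
    and D: "pos_def (D + \<omega> *\<^sub>R P a)" and \<omega>: "0 \<le> \<omega>"
  obtains \<delta> where "\<delta> > 0" "a + \<delta> \<le> b" "\<And>t. t \<in> {a..a+\<delta>} \<Longrightarrow> pos_semidef (P t)"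
proof -
  \<comment> \<open>The remainder of the first-order expansion at \<open>a\<close>, divided by the
    elapsed time.\<close>
  define E where "E t = (1 / norm (t - a)) *\<^sub>R (P t - (P a + (t - a) *\<^sub>R D))" for t
  define M where "M t = E t + (D + \<omega> *\<^sub>R P a)" for t
  have "(E \<longlongrightarrow> 0) (at a within {a..b})"
    using der unfolding has_vector_derivative_def has_derivative_within E_def[abs_def] by simp
  then have lim: "(M \<longlongrightarrow> D + \<omega> *\<^sub>R P a) (at a within {a..b})"
    unfolding M_def[abs_def] by (rule tendsto_add[where a = 0, simplified]) simp
  have "transpose (D + \<omega> *\<^sub>R P a) = D + \<omega> *\<^sub>R P a" using D by (simp add: pos_def_def)
  then have symD: "transpose D = D" using sym by (simp add: transpose_add transpose_scaleR)
  have "transpose (A - B) = transpose A - transpose B" for A B :: "real^'p^'p"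
    by (simp add: transpose_def vec_eq_iff)
  then have "transpose (M t) = M t" for t
    using sym symD by (simp add: M_def E_def transpose_add transpose_scaleR)
  from pos_def_eventually[OF D lim this]
  obtain d where d: "d > 0" "\<And>t. t \<in> {a..b} \<Longrightarrow> t \<noteq> a \<Longrightarrow> dist t a < d \<Longrightarrow> pos_def (M t)"
    by (auto simp: eventually_at)
  \<comment> \<open>The three bounds keep \<open>M t\<close> definite, keep \<open>t\<close> in the
    interval, and keep \<open>1 - (t - a) * \<omega>\<close> nonnegative; the summand 1 covers
    \<open>\<omega> = 0\<close>.\<close>
  define \<delta> where "\<delta> = min (min (d / 2) (b - a)) (1 / (\<omega> + 1))"
  have "\<delta> > 0" using d(1) ab \<omega> by (simp add: \<delta>_def)
  moreover have "\<delta> \<le> min (d / 2) (b - a)" "\<delta> \<le> 1 / (\<omega> + 1)"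
    unfolding \<delta>_def by (rule min.cobounded1, rule min.cobounded2)
  ultimately have \<delta>: "\<delta> > 0" "\<delta> \<le> d / 2" "\<delta> \<le> b - a" "\<delta> \<le> 1 / (\<omega> + 1)"
    by linarith+
  have "pos_semidef (P t)" if t: "t \<in> {a..a+\<delta>}" for t
  proof (cases "t = a")
    case False
    with t have ta: "t - a > 0" by simp
    have "(t - a) * \<omega> \<le> \<delta> * (\<omega> + 1)"
      using t \<omega> \<delta>(1) by (intro mult_mono) auto
    also have "\<dots> \<le> 1 / (\<omega> + 1) * (\<omega> + 1)"
      using \<delta>(4) \<omega> by (intro mult_right_mono) auto
    finally have le: "0 \<le> 1 - (t - a) * \<omega>" using \<omega> by simp
    have "pos_def (M t)" using t False \<delta> d(1) by (intro d(2)) (auto simp: dist_real_def)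
    then have "pos_semidef ((1 - (t - a) * \<omega>) *\<^sub>R P a + (t - a) *\<^sub>R M t)"
      using ta le Pa by (intro pos_semidef_add pos_semidef_scaleR pos_def_imp_pos_semidef[of "M t"]) auto
    moreover have "(t - a) *\<^sub>R E t = P t - (P a + (t - a) *\<^sub>R D)" using ta by (simp add: E_def)
    then have "(1 - (t - a) * \<omega>) *\<^sub>R P a + (t - a) *\<^sub>R M t = P t"
      by (simp add: M_def algebra_simps)
    ultimately show ?thesis by simp
  qed (use Pa in simp)
  with \<delta> show thesis by (intro that[of \<delta>]) auto
qed

section \<open>Symmetry of the recursion and its derivative along the closed loop\<close>

lemma transpose_zero: "transpose (0 :: real^'n^'m) = 0"
  by (simp add: transpose_def vec_eq_iff)

lemma transpose_lie:
  assumes "\<And>y. transpose (A y) = A y"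
  shows "transpose (lie w A x) = lie w A x"
proof -
  have "A y $ i $ j = A y $ j $ i" for y i j
    using arg_cong[OF assms[of y], of "\<lambda>M. M $ j $ i"] by (simp add: transpose_def)
  then show ?thesis by (simp add: transpose_def lie_def vec_eq_iff)
qed

lemma transpose_Psi:
  assumes "\<And>x. transpose (H x) = H x"
  shows "transpose (Psi f \<alpha> H i x) = Psi f \<alpha> H i x"
  using assms
proof (induction f \<alpha> H i arbitrary: x rule: Psi.induct)
  case (3 f \<alpha> H i)
  then have "transpose (Psi f \<alpha> H (Suc i) y) = Psi f \<alpha> H (Suc i) y" for y by blast
  then show ?case by (simp add: transpose_add transpose_lie transpose_spectral_map)
qed simp_all

lemma transpose_Psi_dot:
  assumes "\<And>x. transpose (H x) = H x"
  shows "transpose (Psi_dot f g \<alpha> H i x u) = Psi_dot f g \<alpha> H i x u"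
proof -
  have "transpose (\<Sum>j\<in>J. u $ j *\<^sub>R lie (\<lambda>y. column j (g y)) (Psi f \<alpha> H i) x)
      = (\<Sum>j\<in>J. u $ j *\<^sub>R lie (\<lambda>y. column j (g y)) (Psi f \<alpha> H i) x)" for J
    by (induction J rule: infinite_finite_induct)
       (auto simp: transpose_add transpose_scaleR transpose_lie[OF transpose_Psi[OF assms]]
         transpose_zero)
  then show ?thesis
    by (simp add: Psi_dot_def transpose_add transpose_lie[OF transpose_Psi[OF assms]])
qed

text \<open>Linearity of the derivative in its direction. Besides the closed loop, this is applied
  to a constant input, where it yields continuity of \<open>Psi_dot\<close> in the state.\<close>

lemma ddir_closed_loop_eq_Psi_dot:
  assumes "Psi f \<alpha> H i differentiable (at x)"
  shows "ddir (\<lambda>x. f x + g x *v k x) (Psi f \<alpha> H i) x = Psi_dot f g \<alpha> H i x (k x)"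
proof -
  let ?D = "frechet_derivative (Psi f \<alpha> H i) (at x)"
  have lin: "linear ?D" using assms by (rule linear_frechet_derivative)
  have "g x *v k x = (\<Sum>j\<in>UNIV. k x $ j *\<^sub>R column j (g x))"
    by (simp add: matrix_mult_sum scalar_mult_eq_scaleR)
  then show ?thesis
    by (simp add: Psi_dot_def lie_eq_ddir[OF assms] ddir_def linear_add[OF lin] linear_sum[OF lin]
        linear_scale[OF lin])
qed

subsection \<open>High-order matrix control barrier functions\<close>

text \<open>The inputs allowed by the barrier condition when \<open>\<alpha>\<^sub>r\<close> is the
  identity. The weight is quantified away because the feedback has to select only the input;
  invariance uses just some weight at each point.\<close>

definition decay_admissible :: "(real^'n \<Rightarrow> real^'n) \<Rightarrow> (real^'n \<Rightarrow> real^'m^'n)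
    \<Rightarrow> (nat \<Rightarrow> real \<Rightarrow> real) \<Rightarrow> (real^'n \<Rightarrow> real^'p^'p) \<Rightarrow> nat
    \<Rightarrow> real^'n \<Rightarrow> (real^'m) set" where
  "decay_admissible f g \<alpha> H r x =
     {u. \<exists>\<omega>\<ge>0. pos_def (Psi_dot f g \<alpha> H r x u + \<omega> *\<^sub>R Psi f \<alpha> H r x)}"

lemma decay_admissible_nonempty:
  fixes f :: "real^'n \<Rightarrow> real^'n" and g :: "real^'n \<Rightarrow> real^'m^'n" and H :: "real^'n \<Rightarrow> real^'p^'p"
  assumes smooth: "smooth f" "smooth g" "smooth H" and H: "\<And>x. transpose (H x) = H x"
    and C: "\<And>i. i \<in> {1..r} \<Longrightarrow> Ck (r - i + 1) (Psi f \<alpha> H i)"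
    and lvl: "first_control_level f g \<alpha> H r"
    and psd: "pos_semidef (Psi f \<alpha> H r x)"
    and mrd: "\<not> pos_def (Psi f \<alpha> H r x) \<Longrightarrow> matrix_relative_degree f g \<alpha> H r x"
  shows "decay_admissible f g \<alpha> H r x \<noteq> {}"
proof -
  let ?A = "Psi f \<alpha> H r x" and ?L = "lie f (Psi f \<alpha> H r) x"
  note sym = transpose_Psi[of H f \<alpha>, OF H] transpose_Psi_dot[of H f g \<alpha>, OF H]
  have "\<exists>u. \<forall>v. v \<noteq> 0 \<longrightarrow> ?A *v v = 0 \<longrightarrow> 0 < v \<bullet> (Psi_dot f g \<alpha> H r x u *v v)"
  \<comment> \<open>For a definite matrix the kernel is trivial and any input serves.\<close>
  proof (cases "pos_def ?A")
    case True
    then have "v = 0" if "?A *v v = 0" for v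
      using that unfolding pos_def_def by (metis inner_zero_right less_irrefl)
    then show ?thesis by blast
  next
    case False
    define M where "M u = (\<Sum>j\<in>UNIV. u $ j *\<^sub>R lie (\<lambda>y. column j (g y)) (Psi f \<alpha> H r) x)"
      for u :: "real^'m"
    have M_eq: "M u = (\<Sum>j\<in>UNIV. u $ j *\<^sub>R lie (\<lambda>y. column j (g y)) ((lie f ^^ (r - 1)) H) x)" for u
      using lie_g_Psi[OF smooth C lvl] by (simp add: M_def)
    have E: "eigenspace ?A (min_eigenvalue ?A) = {v. ?A *v v = 0}"
      by (simp add: min_eigenvalue_degenerate[OF psd False] eigenspace_def)
    obtain q V u where V: "orthonormal_basis_of q V {v. ?A *v v = 0}"
      and pd: "pos_def_upto q (\<lambda>a b. V a \<bullet> (M u *v V b))"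
      using mrd[OF False] unfolding matrix_relative_degree_def Let_def E M_eq[symmetric] by blast
    let ?K = "sphere 0 1 \<inter> {v. ?A *v v = 0}"
    have pos: "0 < v \<bullet> (M u *v v)" if "v \<in> ?K" for v
      by (rule pos_def_upto_imp_pos_on_span[OF V pd]) (use that in auto)
    have "closed {v. ?A *v v = 0}"
      by (intro closed_Collect_eq continuous_intros matrix_vector_mult_linear_continuous_on)
    then have K: "compact ?K" by (intro compact_Int_closed compact_sphere)
    \<comment> \<open>Here the penalty weight becomes a scaling of the input: on the unit sphere of
      the kernel a large multiple of \<open>M u\<close> outweighs the drift.\<close>
    obtain t where t: "\<And>v. v \<in> ?K \<Longrightarrow> 0 < v \<bullet> (?L *v v) + t * (v \<bullet> (M u *v v))"
    proof (rule compact_penalty[OF K continuous_on_quadratic_form continuous_on_quadratic_form])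
      fix v assume "v \<in> ?K"
      from pos[OF this] show "0 \<le> v \<bullet> (M u *v v)" "v \<bullet> (M u *v v) = 0 \<Longrightarrow> 0 < v \<bullet> (?L *v v)" by auto
    qed blast
    have Psi_dot: "Psi_dot f g \<alpha> H r x (t *\<^sub>R u) = ?L + t *\<^sub>R M u"
      by (simp add: Psi_dot_def M_def scaleR_sum_right)
    have "0 < v \<bullet> (Psi_dot f g \<alpha> H r x (t *\<^sub>R u) *v v)" if "v \<noteq> 0" "?A *v v = 0" for v
    proof -
      have "v /\<^sub>R norm v \<in> ?K" using that by (simp add: matrix_vector_mult_scaleR)
      from t[OF this] show ?thesis
        unfolding Psi_dot quadratic_form_normalize[OF that(1)]
        using that(1) by (intro mult_pos_pos)
          (simp_all add: matrix_vector_mult_add_rdistrib scaleR_matrix_vector_assoc[symmetric]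
            inner_add_right del: inner_scaleR_left)
    qed
    then show ?thesis by blast
  qed
  then obtain u where u: "\<And>v. v \<noteq> 0 \<Longrightarrow> ?A *v v = 0 \<Longrightarrow> 0 < v \<bullet> (Psi_dot f g \<alpha> H r x u *v v)"
    by blast
  obtain \<omega> where "0 \<le> \<omega>" "pos_def (Psi_dot f g \<alpha> H r x u + \<omega> *\<^sub>R ?A)"
    using pos_def_penalty[OF psd sym(2) u] .
  then show ?thesis by (auto simp: decay_admissible_def)
qed

text \<open>\<open>Psi_dot\<close> is affine in the input, so averaging two inputs along with their
  weights averages the two definite matrices.\<close>

lemma decay_admissible_convex:
  "convex (decay_admissible f g \<alpha> H r x)"
proof (rule convexI)
  let ?A = "Psi f \<alpha> H r x" and ?D = "Psi_dot f g \<alpha> H r x"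
  fix u v and s t :: real
  assume u: "u \<in> decay_admissible f g \<alpha> H r x" and v: "v \<in> decay_admissible f g \<alpha> H r x"
    and st: "0 \<le> s" "0 \<le> t" "s + t = 1"
  obtain a where a: "0 \<le> a" "pos_def (?D u + a *\<^sub>R ?A)" using u by (auto simp: decay_admissible_def)
  obtain b where b: "0 \<le> b" "pos_def (?D v + b *\<^sub>R ?A)" using v by (auto simp: decay_admissible_def)
  have D: "?D (s *\<^sub>R u + t *\<^sub>R v) = s *\<^sub>R ?D u + t *\<^sub>R ?D v"
  proof -
    have "lie f (Psi f \<alpha> H r) x = s *\<^sub>R lie f (Psi f \<alpha> H r) x + t *\<^sub>R lie f (Psi f \<alpha> H r) x"
      using st by (simp flip: scaleR_left_distrib)
    then show ?thesis
      by (simp add: Psi_dot_def scaleR_right_distrib scaleR_left_distrib sum.distrib scaleR_sum_right)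
  qed
  have eq: "?D (s *\<^sub>R u + t *\<^sub>R v) + (s * a + t * b) *\<^sub>R ?A
      = s *\<^sub>R (?D u + a *\<^sub>R ?A) + t *\<^sub>R (?D v + b *\<^sub>R ?A)"
    by (simp add: D scaleR_right_distrib scaleR_left_distrib)
  have "pos_def (s *\<^sub>R (?D u + a *\<^sub>R ?A) + t *\<^sub>R (?D v + b *\<^sub>R ?A))"
  \<comment> \<open>Definiteness of the sum needs one summand with a positive coefficient; the other
    may be merely semidefinite.\<close>
  proof (cases "s = 0")
    case True
    with st b show ?thesis by simp
  next
    case False
    with st have "pos_def (s *\<^sub>R (?D u + a *\<^sub>R ?A))" by (intro pos_def_scaleR a(2)) simp
    moreover have "pos_semidef (t *\<^sub>R (?D v + b *\<^sub>R ?A))"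
      using st by (intro pos_semidef_scaleR pos_def_imp_pos_semidef b(2))
    ultimately show ?thesis by (rule pos_def_add_pos_semidef)
  qed
  then have "pos_def (?D (s *\<^sub>R u + t *\<^sub>R v) + (s * a + t * b) *\<^sub>R ?A)" by (simp only: eq)
  moreover have "0 \<le> s * a + t * b" using st a(1) b(1) by simp
  ultimately show "s *\<^sub>R u + t *\<^sub>R v \<in> decay_admissible f g \<alpha> H r x"
    by (auto simp: decay_admissible_def)
qed

text \<open>Input and weight are both kept fixed; the inequality then says that a matrix depending
  continuously on the state is definite, which is an open condition.\<close>

lemma decay_admissible_open_fibre:
  fixes f :: "real^'n \<Rightarrow> real^'n" and g :: "real^'n \<Rightarrow> real^'m^'n" and H :: "real^'n \<Rightarrow> real^'p^'p"
  assumes smooth: "smooth f" "smooth g" and H: "\<And>x. transpose (H x) = H x"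
    and C: "Ck (Suc 0) (Psi f \<alpha> H r)"
    and u: "u \<in> decay_admissible f g \<alpha> H r x"
  shows "\<exists>T. open T \<and> x \<in> T \<and> (\<forall>y\<in>T. u \<in> decay_admissible f g \<alpha> H r y)"
proof -
  note sym = transpose_Psi[of H f \<alpha>, OF H] transpose_Psi_dot[of H f g \<alpha>, OF H]
  obtain \<omega> where \<omega>: "0 \<le> \<omega>" "pos_def (Psi_dot f g \<alpha> H r x u + \<omega> *\<^sub>R Psi f \<alpha> H r x)"
    using u by (auto simp: decay_admissible_def)
  have contF: "continuous_on UNIV (\<lambda>x. f x + g x *v u)"
    using smooth[THEN smooth_def[THEN iffD1], rule_format, THEN Ck_continuous]
    by (intro continuous_intros bounded_bilinear.continuous_on[OF matrix_vector_bounded_bilinear])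
  then have "Ck 0 (\<lambda>x. f x + g x *v u)" by simp
  from Ck_continuous[OF Ck_ddir[OF C this]]
  have "continuous_on UNIV (\<lambda>x. Psi_dot f g \<alpha> H r x u)"
    using ddir_closed_loop_eq_Psi_dot[OF Ck_differentiable[OF C], of g "\<lambda>_. u"] by simp
  then have "continuous_on UNIV (\<lambda>y. Psi_dot f g \<alpha> H r y u + \<omega> *\<^sub>R Psi f \<alpha> H r y)"
    by (intro continuous_intros Ck_continuous[OF C])
  then have "open {y. pos_def (Psi_dot f g \<alpha> H r y u + \<omega> *\<^sub>R Psi f \<alpha> H r y)}"
    by (rule open_pos_def) (simp add: transpose_add transpose_scaleR sym)
  with \<omega> show ?thesis
    by (intro exI[of _ "{y. pos_def (Psi_dot f g \<alpha> H r y u + \<omega> *\<^sub>R Psi f \<alpha> H r y)}"])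
      (auto simp: decay_admissible_def)
qed

text \<open>The decay inequality is available only at states of the safe set, so it is used only at
  the instant \<open>t\<close>. Short-time expansion gives level \<open>r\<close> on an interval
  after \<open>t\<close>, and on that same interval each lower level follows from the one
  above.\<close>

lemma forward_invariant_safe_set:
  fixes f :: "real^'n \<Rightarrow> real^'n" and g :: "real^'n \<Rightarrow> real^'m^'n" and H :: "real^'n \<Rightarrow> real^'p^'p"
  assumes H: "\<And>x. transpose (H x) = H x"
    and Ke: "\<And>i. i \<in> {1..<r} \<Longrightarrow> class_Ke (\<alpha> i)"
    and C: "\<And>i. 1 \<le> i \<Longrightarrow> i \<le> r \<Longrightarrow> Ck (Suc 0) (Psi f \<alpha> H i)"
    and lvl: "first_control_level f g \<alpha> H r"
    and S: "closed (safe_set f \<alpha> H r)"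
    and k: "\<And>x. x \<in> safe_set f \<alpha> H r \<Longrightarrow> k x \<in> decay_admissible f g \<alpha> H r x"
  shows "forward_invariant (\<lambda>x. f x + g x *v k x) (safe_set f \<alpha> H r)"
  unfolding forward_invariant_def
proof (intro allI impI ballI, elim conjE)
  let ?S = "safe_set f \<alpha> H r" and ?P = "Psi f \<alpha> H"
  fix J :: "real set" and x :: "real \<Rightarrow> real^'n" and T
  assume J: "is_interval J" "0 \<in> J" "J \<subseteq> {0..}" and T: "T \<in> J" and x0: "x 0 \<in> ?S"
    and sol: "\<forall>t\<in>J. (x has_vector_derivative f (x t) + g (x t) *v k (x t)) (at t within J)"
  have r: "1 \<le> r" using lvl by (simp add: first_control_level_def)
  have T0: "0 \<le> T" using T J by auto
  have sub: "{0..T} \<subseteq> J" using J(1,2) T by (meson atLeastAtMost_iff mem_is_interval_1_I subsetI)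
  have derP: "((\<lambda>t. ?P i (x t)) has_vector_derivative Psi_dot f g \<alpha> H i (x t) (k (x t)))
      (at t within {a..b})" if i: "1 \<le> i" "i \<le> r" and t: "t \<in> {a..b}" "0 \<le> a" "b \<le> T" for i t a b
  proof -
    note d = Ck_differentiable[OF C[OF i]]
    have "(x has_vector_derivative f (x t) + g (x t) *v k (x t)) (at t within {a..b})"
      by (rule has_vector_derivative_within_subset[OF sol[rule_format]]) (use sub t in auto)
    then have "(?P i \<circ> x has_vector_derivative ddir (\<lambda>x. f x + g x *v k x) (?P i) (x t))
        (at t within {a..b})"
      unfolding ddir_def
      by (rule vector_derivative_diff_chain_within)
         (simp add: d frechet_derivative_works[symmetric] has_derivative_at_withinI)
    then show ?thesis by (simp add: ddir_closed_loop_eq_Psi_dot[OF d] o_def)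
  qed
  \<comment> \<open>Below level \<open>r\<close> the input terms vanish, and the recursion is solved
    for the drift term.\<close>
  have uncontrolled: "Psi_dot f g \<alpha> H i y u = ?P (Suc i) y - spectral_map (\<alpha> i) (?P i y)"
    if i: "1 \<le> i" "i < r" for i y u
  proof -
    have "Psi_dot f g \<alpha> H i y u = lie f (?P i) y"
      using lvl i by (simp add: Psi_dot_def first_control_level_def)
    also have "\<dots> = ?P (Suc i) y - spectral_map (\<alpha> i) (?P i y)" using i by (cases i) auto
    finally show ?thesis .
  qed
  have mem: "x t \<in> ?S \<longleftrightarrow> (\<forall>i. 1 \<le> i \<and> i \<le> r \<longrightarrow> pos_semidef (?P i (x t)))" for t
    by (auto simp: safe_set_def Cset_def)
  show "x T \<in> ?S"
  proof (rule stays_in_closed_set[where a = 0 and b = T and x = x and S = ?S, OF T0 _ S x0])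
    show "continuous_on {0..T} x"
      using sol sub has_vector_derivative_continuous
      by (metis continuous_on_eq_continuous_within continuous_on_subset)
    fix t assume t: "0 \<le> t" "t < T" "x t \<in> ?S"
    obtain \<omega> where \<omega>: "0 \<le> \<omega>" "pos_def (Psi_dot f g \<alpha> H r (x t) (k (x t)) + \<omega> *\<^sub>R ?P r (x t))"
      using k[OF t(3)] by (auto simp: decay_admissible_def)
    have psd: "pos_semidef (?P i (x t))" if "1 \<le> i" "i \<le> r" for i
      using t(3) that by (simp add: mem)
    have "((\<lambda>t. ?P r (x t)) has_vector_derivative Psi_dot f g \<alpha> H r (x t) (k (x t))) (at t within {t..T})"
      using r t by (intro derP) auto
    then obtain \<delta> where \<delta>: "\<delta> > 0" "t + \<delta> \<le> T" "\<And>s. s \<in> {t..t+\<delta>} \<Longrightarrow> pos_semidef (?P r (x s))"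
      using pos_semidef_short_time[where P = "\<lambda>s. ?P r (x s)" and a = t and b = T and \<omega> = \<omega>,
          OF _ t(2) psd[OF r order.refl] transpose_Psi[of H f \<alpha>, OF H] \<omega>(2,1)] by metis
    have "pos_semidef (?P i (x s))" if "1 \<le> i" "i \<le> r" "s \<in> {t..t+\<delta>}" for i s
      using that(2,1,3)
    \<comment> \<open>Downward induction from \<open>r\<close>, since the comparison at level
      \<open>i\<close> needs semidefiniteness at level \<open>Suc i\<close> over the whole
      interval.\<close>
    proof (induction i arbitrary: s rule: inc_induct)
      case base
      then show ?case using \<delta>(3) by simp
    next
      case (step i)
      show ?case
      proof (rule pos_semidef_comparison[where P = "\<lambda>s. ?P i (x s)" and R = "\<lambda>s. ?P (Suc i) (x s)"])
        show "class_Ke (\<alpha> i)" using Ke step by simp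
        show "((\<lambda>s. ?P i (x s)) has_vector_derivative ?P (Suc i) (x s) - spectral_map (\<alpha> i) (?P i (x s)))
            (at s within {t..t+\<delta>})" if "s \<in> {t..t+\<delta>}" for s
          using derP[of i s t "t + \<delta>"] uncontrolled[of i] step that t \<delta>(2) by simp
        show "pos_semidef (?P (Suc i) (x s))" if "s \<in> {t..t+\<delta>}" for s
          using step that by simp
        show "pos_semidef (?P i (x t))" using psd step by simp
      qed (use step transpose_Psi[of H f \<alpha>, OF H] in auto)
    qed
    then show "\<exists>\<delta>>0. \<forall>s\<in>{t..t+\<delta>} \<inter> {0..T}. x s \<in> ?S"
      using \<delta>(1) by (intro exI[of _ \<delta>]) (auto simp: mem)
  qed
qed

theorem theorem4:
  fixes f :: "real^'n \<Rightarrow> real^'n"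
    and g :: "real^'n \<Rightarrow> real^'m^'n"
    and H :: "real^'n \<Rightarrow> real^'p^'p"
    and \<alpha> :: "nat \<Rightarrow> real \<Rightarrow> real"
    and r :: nat
  assumes "smooth f" and "smooth g" and "smooth H"
    and "\<And>x. transpose (H x) = H x"
    and "\<And>i. i \<in> {1..<r} \<Longrightarrow> class_Ke (\<alpha> i)"
    and "\<And>i. i \<in> {1..r} \<Longrightarrow> Ck (r - i + 1) (Psi f \<alpha> H i)"
    and "first_control_level f g \<alpha> H r"
    and "{x \<in> safe_set f \<alpha> H r. \<not> pos_def (Psi f \<alpha> H r x)}
           = frontier (safe_set f \<alpha> H r) \<inter> frontier (Cset f \<alpha> H r)"
    and "\<exists>U. open U \<and> frontier (safe_set f \<alpha> H r) \<inter> frontier (Cset f \<alpha> H r) \<subseteq> U \<and>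
           (\<forall>x\<in>U. matrix_relative_degree f g \<alpha> H r x)"
  shows "OD_HOMCBF f g \<alpha> H r \<and>
    (\<exists>k :: real^'n \<Rightarrow> real^'m. continuous_on UNIV k \<and>
       forward_invariant (\<lambda>x. f x + g x *v k x) (safe_set f \<alpha> H r))"
proof -
  let ?S = "safe_set f \<alpha> H r" and ?P = "Psi f \<alpha> H"
  have r: "1 \<le> r" using assms(7) by (simp add: first_control_level_def)
  have C1: "Ck (Suc 0) (?P i)" if "1 \<le> i" "i \<le> r" for i
    by (rule Ck_le[OF _ assms(6)]) (use that in auto)
  have psd: "pos_semidef (?P r x)" if "x \<in> ?S" for x
    using that r by (auto simp: safe_set_def Cset_def)
  \<comment> \<open>The singular points of the safe set are by assumption those of the two
    frontiers' intersection, where the relative degree condition holds.\<close>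
  have ne: "decay_admissible f g \<alpha> H r x \<noteq> {}" if x: "x \<in> ?S" for x
    by (rule decay_admissible_nonempty[OF assms(1-4) assms(6,7) psd[OF x]]) (use assms(8,9) x in blast)+
  have "closed ?S"
    unfolding safe_set_def Cset_def
    by (intro closed_INT ballI closed_pos_semidef Ck_continuous[OF C1] transpose_Psi[OF assms(4)]) auto
  then obtain k where k: "continuous_on UNIV k" "\<And>x. x \<in> ?S \<Longrightarrow> k x \<in> decay_admissible f g \<alpha> H r x"
  proof (rule continuous_selection_open_fibres[OF _ decay_admissible_convex ne])
    show "\<exists>T. open T \<and> x \<in> T \<and> (\<forall>y\<in>T \<inter> ?S. u \<in> decay_admissible f g \<alpha> H r y)"
      if "u \<in> decay_admissible f g \<alpha> H r x" for x u
      using decay_admissible_open_fibre[OF assms(1,2,4) C1[OF r order.refl] that] by blast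
  qed blast+
  \<comment> \<open>The input selected by the feedback \<open>k\<close> also witnesses the barrier
    condition, with the identity as \<open>\<alpha>\<^sub>r\<close>.\<close>
  have "OD_HOMCBF f g \<alpha> H r"
    unfolding OD_HOMCBF_def
  proof (intro exI[of _ "\<lambda>s. s"] conjI ballI)
    show "class_Ke (\<lambda>s. s)" by (simp add: class_Ke_def strict_mono_def)
    fix x assume "x \<in> ?S"
    then have "k x \<in> decay_admissible f g \<alpha> H r x" by (rule k(2))
    then show "\<exists>u \<omega>. 0 \<le> \<omega> \<and>
        pos_def (Psi_dot f g \<alpha> H r x u - (- (\<omega> *\<^sub>R spectral_map (\<lambda>s. s) (?P r x))))"
      by (auto simp: decay_admissible_def spectral_map_id[OF transpose_Psi[OF assms(4)]])
  qed
  moreover have "forward_invariant (\<lambda>x. f x + g x *v k x) ?S"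
    by (rule forward_invariant_safe_set[OF assms(4,5) C1 assms(7) \<open>closed ?S\<close> k(2)])
  ultimately show ?thesis using k(1) by blast
qed

end
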